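(* Let $\lambda<0$, let $n\ge3$ be an integer, let $R>0$, and suppose $v_0(R)=0$. Then there exists $t_c\in(0,\infty)$ such that $X(t_c,R)=0$ or $\Gamma(t_c,R)=0$ if and only if one of the following three conditions holds (where $C$, $\partial_rC$, $v_0'$ are evaluated at $R$): (1) $\partial_rC<0$; (2) $\partial_rC=0$ and one of: (a) $n=3$; (b) $n=4$ and $v_0'R<0$; (c) $n\ge5$ and $v_0'R<-\frac{(n-2)\sqrt C}{2}(1-I_n)$, where $I_n$ is the constant $$I_n:=\int_1^\infty\Big((1-y^{-2})^{-\frac1{n-2}}-1\Big)dy<1;$$ (3) $\partial_rC>0$ and one of: (a) $n=3$ and $$v_0'R\le-\frac34\sqrt{C+R\partial_rC}+\frac{\sqrt C}{2}\Big(1-\frac{R\partial_rC}{2C}\Big)\log\left(\frac{\sqrt C+\sqrt{C+R\partial_rC}}{\sqrt{R\partial_rC}}\right);$$ (b) $n=4$ and $v_0'R\le-\sqrt{2R\partial_rC}$; (c) $n\ge5$ and $$v_0'R\le-\frac{(n-2)^{\frac12}(R\partial_rC)^{\frac32}}{4C}\Big(1+\frac{(n-2)C}{R\partial_rC}\Big)^{\frac{n}{2(n-2)}}-\frac{(n-2)C^{\frac12}}{2}\Big(1-\frac{R\partial_rC}{2C}\Big)\left[\Big(1+\frac{R\partial_rC}{(n-2)C}\Big)^{\frac12}-\int_{\left(1+\frac{R\partial_rC}{(n-2)C}\right)^{\frac12}}^\infty\Big((1-y^{-2})^{-\frac1{n-2}}-1\Big)dy\right].$$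
   Context: Data: $\rho_0\in C([0,\infty))$, $\rho_0\ge0$; $v_0\in C([0,\infty))\cap C^1((0,\infty))$ with $v_0(0)=0$; $v_0'$ is the derivative of $v_0$. Put $m_0(r)=\int_0^r\rho_0(s)s^{n-1}ds$, $A(r)=\frac{2|\lambda|m_0(r)}{n-2}$, $C(r)=v_0(r)^2+A(r)r^{-(n-2)}$. For each $R>0$, $X(t,R)$ (the characteristic curve of the radial Euler-Poisson system) is the solution of $$X''(t,R)=-\frac{\lambda m_0(R)}{X(t,R)^{n-1}},\quad X'(0,R)=v_0(R),\quad X(0,R)=R,$$ where primes on $X$ are $t$-derivatives, continued up to the first time (if any) at which $X$ reaches $0$; and $\Gamma(t,R)=\partial_RX(t,R)$. A necessary and sufficient condition for the existence of $t_c\in(0,\infty)$ with $X(t_c,R)=0$ or $\Gamma(t_c,R)=0$ is called a pointwise condition for finite-time breakdown (PCFB) at $R$.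
   Formalization: For n=3 the condition m_0(R)>0 (equivalently C(R)>0) is added: with n=3, ρ_0=0 and v_0=0, case (2)(a) would assert breakdown, although X(t,R)=R and Γ(t,R)=1 for all t. *)

theory Defs
  imports "HOL-Analysis.Analysis"
begin

text \<open>
  Radially symmetric Euler--Poisson system in dimension n with initial density rho0, initial
  velocity v0 and coupling constant lam (lam < 0 is the repulsive case).  Only values of rho0 and
  v0 on the half-line [0,oo) are ever used.
\<close>

definition mass :: "nat \<Rightarrow> (real \<Rightarrow> real) \<Rightarrow> real \<Rightarrow> real" where
  "mass n rho0 r = integral {0..r} (\<lambda>s. rho0 s * s ^ (n - 1))"

definition A_fun :: "real \<Rightarrow> nat \<Rightarrow> (real \<Rightarrow> real) \<Rightarrow> real \<Rightarrow> real" where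
  "A_fun lam n rho0 r = 2 * \<bar>lam\<bar> * mass n rho0 r / (real n - 2)"

definition C_fun ::
  "real \<Rightarrow> nat \<Rightarrow> (real \<Rightarrow> real) \<Rightarrow> (real \<Rightarrow> real) \<Rightarrow> real \<Rightarrow> real" where
  "C_fun lam n rho0 v0 r = (v0 r)\<^sup>2 + A_fun lam n rho0 r / r ^ (n - 2)"

definition admissible_data :: "(real \<Rightarrow> real) \<Rightarrow> (real \<Rightarrow> real) \<Rightarrow> bool" where
  "admissible_data rho0 v0 \<longleftrightarrow>
     continuous_on {0..} rho0 \<and> (\<forall>r\<ge>0. 0 \<le> rho0 r) \<and>
     continuous_on {0..} v0 \<and> v0 C1_differentiable_on {0<..} \<and> v0 0 = 0"

text \<open>
  The curve x is the characteristic curve starting at R, with lifespan T (possibly infinite).  If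
  T is finite, then T is the first time at which x reaches 0, approached continuously; values of
  x after T are irrelevant.  The derivatives within [0,oo) are ordinary two-sided derivatives for
  t > 0 and right derivatives at t = 0.
\<close>

definition characteristic_curve ::
  "real \<Rightarrow> nat \<Rightarrow> (real \<Rightarrow> real) \<Rightarrow> (real \<Rightarrow> real) \<Rightarrow> real \<Rightarrow> ereal \<Rightarrow> (real \<Rightarrow> real) \<Rightarrow> bool" where
  "characteristic_curve lam n rho0 v0 R T x \<longleftrightarrow>
     0 < T \<and> x 0 = R \<and>
     (\<forall>t. 0 \<le> t \<and> ereal t < T \<longrightarrow> 0 < x t) \<and>
     (\<exists>x'. x' 0 = v0 R \<and>
        (\<forall>t. 0 \<le> t \<and> ereal t < T \<longrightarrow>
           (x has_real_derivative x' t) (at t within {0..}) \<and>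
           (x' has_real_derivative (- lam * mass n rho0 R / x t ^ (n - 1)))
             (at t within {0..}))) \<and>
     (\<forall>\<tau>. T = ereal \<tau> \<longrightarrow> x \<tau> = 0 \<and> (x \<longlongrightarrow> 0) (at_left \<tau>))"

text \<open>
  The constant called I with index n is tail_integral n 1.  The value of the integrand at y = 1 (where
  0 powr a is 0) does not affect the integral.
\<close>

definition tail_integral :: "nat \<Rightarrow> real \<Rightarrow> real" where
  "tail_integral n a =
     integral {a..} (\<lambda>y. (1 - 1 / y\<^sup>2) powr (- (1 / (real n - 2))) - 1)"

end

theory Submission
  imports Defs
begin

text \<open>
  Since \<open>v\<^sub>0(R) = 0\<close> and the force is repulsive, \<open>X(t,R) \<ge> R\<close> for all times, so only
  \<open>\<Gamma> = 0\<close> can cause breakdown. The function \<open>\<Gamma>\<close> solves the linearized equation, whose solutions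
  are known explicitly from the symmetries of the equation (scaling and time translation). With
  \<open>p = n - 2\<close>, \<open>X = R \<xi>(\<tau>)\<close>, \<open>\<tau> = \<surd>C t / R\<close>, where \<open>\<xi>'\<^sup>2 = 1 - \<xi> powr -p\<close> and \<open>\<xi>(0) = 1\<close>, one finds
  \<open>\<Gamma> = \<xi> - (1 - h) \<tau> \<xi>' + w \<xi>'\<close> with \<open>h = R \<partial>\<^sub>rC / (2 C)\<close> and
  \<open>w = 2 v\<^sub>0'R / (p \<surd>C)\<close>. Breakdown therefore means that \<open>-w\<close> is a value of
  \<open>\<xi> / \<xi>' - (1 - h) \<tau>\<close>, a function that starts at \<open>+\<infinity>\<close> and has the derivative
  \<open>h - p / (2 (\<xi> powr p - 1))\<close>. Hence it is decreasing for \<open>h \<le> 0\<close>, which calls for its limit at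
  infinity, and has its minimum where \<open>\<xi> powr p = 1 + p / (2 h)\<close> for \<open>h > 0\<close>.
\<close>

section \<open>Differentiability with respect to the starting point\<close>

text \<open>The hypotheses give one curve for each r separately, so neither the survival of
  neighbouring curves up to time t nor the existence of \<Gamma> is known in advance. Gronwall
  estimates supply both and identify \<Gamma> with any solution of the linearized problem, so that
  an explicit solution only has to be verified.

  The three ranges of n come from one formula. With y = 1 / \<xi>' the function for h = 0 equals y -
  J y, and y decreases to 1 as \<tau> tends to infinity, so its limit is 1 - J 1. The integral J 1
  is infinite for p = 1, equals 1 for p = 2, and is the constant I_n < 1 for p \<ge> 3. The limit is
  never attained, whence the strict inequalities for \<partial>_r C = 0; for h > 0 the minimum is
  attained, whence the weak ones.

  If there is no mass within radius R, then C = 0 and the normalization is impossible. There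
  \<Gamma> is affine in t, and this case is treated apart.\<close>

lemma second_order_gronwall:
  fixes e e' e'' :: "real \<Rightarrow> real"
  assumes e: "\<And>s. s \<in> {0..t} \<Longrightarrow> (e has_real_derivative e' s) (at s within {0..t})"
    and e': "\<And>s. s \<in> {0..t} \<Longrightarrow> (e' has_real_derivative e'' s) (at s within {0..t})"
    and bound: "\<And>s. s \<in> {0..t} \<Longrightarrow> \<bar>e'' s\<bar> \<le> \<eta> + L * \<bar>e s\<bar>"
    and "0 \<le> L" "0 \<le> t"
  shows "(e t)\<^sup>2 \<le> ((e 0)\<^sup>2 + (e' 0)\<^sup>2 + \<eta>\<^sup>2) * exp ((2 + L) * t)"
proof -
  \<comment> \<open>The summand \<open>\<eta>\<^sup>2\<close> makes the constant forcing part of the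
    energy, so that completing squares bounds the growth rate by 2 + L and leaves no inhomogeneous
    term.\<close>
  define \<phi> where "\<phi> s = ((e s)\<^sup>2 + (e' s)\<^sup>2 + \<eta>\<^sup>2) * exp (- (2 + L) * s)" for s
  have cont: "continuous_on {0..t} \<phi>"
    unfolding \<phi>_def
    by (intro continuous_intros DERIV_continuous_on[of _ e e'] DERIV_continuous_on[of _ e' e''] e e')
  have "- \<phi> 0 \<le> - \<phi> t"
  proof (rule DERIV_nonneg_imp_increasing_open[OF \<open>0 \<le> t\<close> _ continuous_on_minus[OF cont]])
    fix s assume s: "0 < s" "s < t"
    have de: "(e has_real_derivative e' s) (at s)" "(e' has_real_derivative e'' s) (at s)"
      using e[of s] e'[of s] s by (simp_all add: at_within_Icc_at)
    define D where "D = (2 * e s * e' s + 2 * e' s * e'' s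
        - (2 + L) * ((e s)\<^sup>2 + (e' s)\<^sup>2 + \<eta>\<^sup>2)) * exp (- (2 + L) * s)"
    have "(\<phi> has_real_derivative D) (at s)"
      unfolding \<phi>_def D_def
      by (rule derivative_eq_intros de refl | simp)+ (simp add: algebra_simps)
    moreover have "D \<le> 0"
    proof -
      have "\<bar>e'' s\<bar> \<le> \<eta> + L * \<bar>e s\<bar>" using bound s by auto
      then have "e' s * e'' s \<le> \<bar>e' s\<bar> * (\<eta> + L * \<bar>e s\<bar>)"
        by (metis abs_ge_self abs_mult abs_ge_zero mult_left_mono order_trans)
      then have 1: "2 * e' s * e'' s \<le> 2 * \<bar>e' s\<bar> * \<eta> + L * (2 * \<bar>e' s\<bar> * \<bar>e s\<bar>)"
        by (simp add: algebra_simps)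
      have 2: "2 * \<bar>e' s\<bar> * \<eta> \<le> (e' s)\<^sup>2 + \<eta>\<^sup>2"
        using sum_squares_bound[of "\<bar>e' s\<bar>" \<eta>] by simp
      have 3: "2 * \<bar>e' s\<bar> * \<bar>e s\<bar> \<le> (e' s)\<^sup>2 + (e s)\<^sup>2"
        using sum_squares_bound[of "\<bar>e' s\<bar>" "\<bar>e s\<bar>"] by simp
      have 4: "L * (2 * \<bar>e' s\<bar> * \<bar>e s\<bar>) \<le> L * ((e' s)\<^sup>2 + (e s)\<^sup>2)"
        using 3 \<open>0 \<le> L\<close> by (rule mult_left_mono)
      have 5: "2 * e s * e' s \<le> (e' s)\<^sup>2 + (e s)\<^sup>2"
        using sum_squares_bound[of "e s" "e' s"] by simp
      have 6: "L * ((e' s)\<^sup>2 + (e s)\<^sup>2) \<le> L * ((e s)\<^sup>2 + (e' s)\<^sup>2 + \<eta>\<^sup>2)"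
        using \<open>0 \<le> L\<close> by (intro mult_left_mono) auto
      have "2 * e s * e' s + 2 * e' s * e'' s
          \<le> 2 * ((e s)\<^sup>2 + (e' s)\<^sup>2 + \<eta>\<^sup>2) + L * ((e s)\<^sup>2 + (e' s)\<^sup>2 + \<eta>\<^sup>2)"
        using 1 2 4 5 6 zero_le_power2[of "e s"] zero_le_power2[of \<eta>] by argo
      then have "2 * e s * e' s + 2 * e' s * e'' s
          - (2 + L) * ((e s)\<^sup>2 + (e' s)\<^sup>2 + \<eta>\<^sup>2) \<le> 0"
        by (simp add: distrib_right)
      then show ?thesis unfolding D_def by (intro mult_nonpos_nonneg) simp_all
    qed
    ultimately show "\<exists>D. ((\<lambda>s. - \<phi> s) has_real_derivative D) (at s) \<and> 0 \<le> D"
      by (intro exI[of _ "- D"]) (auto intro: DERIV_minus)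
  qed
  then have "\<phi> t * exp ((2 + L) * t) \<le> \<phi> 0 * exp ((2 + L) * t)" by simp
  moreover have "\<phi> t * exp ((2 + L) * t) = (e t)\<^sup>2 + (e' t)\<^sup>2 + \<eta>\<^sup>2"
    unfolding \<phi>_def mult.assoc exp_add[symmetric] by (simp add: algebra_simps)
  moreover have "\<phi> 0 = (e 0)\<^sup>2 + (e' 0)\<^sup>2 + \<eta>\<^sup>2"
    by (simp add: \<phi>_def)
  ultimately have "(e t)\<^sup>2 + (e' t)\<^sup>2 + \<eta>\<^sup>2
      \<le> ((e 0)\<^sup>2 + (e' 0)\<^sup>2 + \<eta>\<^sup>2) * exp ((2 + L) * t)"
    by simp
  then show ?thesis
    by (rule order_trans[rotated]) simp
qed

section \<open>Lipschitz and Taylor estimates for inverse powers\<close>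

lemma inverse_power_deriv:
  fixes u :: real
  assumes "0 < u"
  shows "((\<lambda>u. 1 / u ^ N) has_real_derivative - (real N / u ^ Suc N)) (at u)"
proof (cases N)
  case (Suc M)
  have "((\<lambda>u. inverse (u ^ N)) has_real_derivative
      - (inverse (u ^ N) * (real N * u ^ M) * inverse (u ^ N))) (at u)"
    using assms Suc DERIV_inverse'[OF DERIV_pow[of N u UNIV]] by simp
  also have "- (inverse (u ^ N) * (real N * u ^ M) * inverse (u ^ N)) = - (real N / u ^ Suc N)"
    using assms Suc by (simp add: field_simps)
  finally show ?thesis by (simp add: inverse_eq_divide)
qed auto

lemma inverse_power_lipschitz:
  fixes a x z :: real
  assumes "0 < a" "a \<le> x" "a \<le> z"
  shows "\<bar>1 / z ^ N - 1 / x ^ N\<bar> \<le> real N / a ^ Suc N * \<bar>z - x\<bar>"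
proof -
  have "norm (1 / z ^ N - 1 / x ^ N) \<le> real N / a ^ Suc N * norm (z - x)"
  proof (rule field_differentiable_bound[of "{a..}" _ "\<lambda>u. - (real N / u ^ Suc N)"])
    fix u assume u: "u \<in> {a..}"
    then show "((\<lambda>u. 1 / u ^ N) has_field_derivative - (real N / u ^ Suc N)) (at u within {a..})"
      using inverse_power_deriv[of u N] assms by (auto intro: has_field_derivative_at_within)
    show "norm (- (real N / u ^ Suc N)) \<le> real N / a ^ Suc N"
      using u assms by (simp add: divide_left_mono power_mono del: power_Suc)
  qed (use assms in auto)
  then show ?thesis by simp
qed

text \<open>Once its linear part at x is removed, 1 / u ^ N has a derivative that vanishes at x; the
  Lipschitz bound with exponent N + 1 makes this derivative O(|z - x|) on the segment. The lost
  factor 1/2 is harmless, since only the quadratic order matters.\<close>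

lemma inverse_power_taylor:
  fixes a x z :: real
  assumes "0 < a" "a \<le> x" "a \<le> z"
  shows "\<bar>1 / z ^ N - 1 / x ^ N + real N / x ^ Suc N * (z - x)\<bar>
    \<le> real N * (real (Suc N) / a ^ Suc (Suc N)) * (z - x)\<^sup>2"
proof -
  let ?S = "closed_segment x z"
  have inS: "a \<le> u" "\<bar>u - x\<bar> \<le> \<bar>z - x\<bar>" if "u \<in> ?S" for u
    using that assms by (auto simp: closed_segment_eq_real_ivl split: if_splits)
  define h where "h u = 1 / u ^ N + real N / x ^ Suc N * u" for u :: real
  have "norm (h z - h x) \<le> (real N * (real (Suc N) / a ^ Suc (Suc N) * \<bar>z - x\<bar>)) * norm (z - x)"
  proof (rule field_differentiable_bound[of ?S _
        "\<lambda>u. - (real N / u ^ Suc N) + real N / x ^ Suc N"])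
    fix u assume u: "u \<in> ?S"
    have "(h has_field_derivative - (real N / u ^ Suc N) + real N / x ^ Suc N) (at u)"
      unfolding h_def using inS[OF u] assms
      by (intro DERIV_add inverse_power_deriv DERIV_cmult_Id) simp
    then show "(h has_field_derivative - (real N / u ^ Suc N) + real N / x ^ Suc N) (at u within ?S)"
      by (rule has_field_derivative_at_within)
    have "\<bar>1 / u ^ Suc N - 1 / x ^ Suc N\<bar> \<le> real (Suc N) / a ^ Suc (Suc N) * \<bar>u - x\<bar>"
      using inverse_power_lipschitz[of a x u "Suc N"] inS[OF u] assms by auto
    also have "\<dots> \<le> real (Suc N) / a ^ Suc (Suc N) * \<bar>z - x\<bar>"
      using inS[OF u] assms by (intro mult_left_mono) auto
    finally have "real N * \<bar>1 / u ^ Suc N - 1 / x ^ Suc N\<bar>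
        \<le> real N * (real (Suc N) / a ^ Suc (Suc N) * \<bar>z - x\<bar>)"
      by (intro mult_left_mono) auto
    moreover have "- (real N / u ^ Suc N) + real N / x ^ Suc N
        = - (real N * (1 / u ^ Suc N - 1 / x ^ Suc N))"
      by (simp add: algebra_simps)
    ultimately show "norm (- (real N / u ^ Suc N) + real N / x ^ Suc N)
        \<le> real N * (real (Suc N) / a ^ Suc (Suc N) * \<bar>z - x\<bar>)"
      by (simp add: abs_mult del: power_Suc)
  qed auto
  moreover have "h z - h x = 1 / z ^ N - 1 / x ^ N + real N / x ^ Suc N * (z - x)"
    by (simp add: h_def algebra_simps diff_divide_distrib)
  ultimately show ?thesis by (simp add: power2_eq_square mult.assoc del: power_Suc)
qed

text \<open>Gronwall's inequality is applied twice: to \<open>X(\<cdot>,r) - X(\<cdot>,R)\<close>, in a continuity argument that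
  keeps \<open>X(\<cdot>,r)\<close> above \<open>R / 2\<close> and hence alive up to time \<open>t\<close>, and then to the remainder
  \<open>X(\<cdot>,r) - X(\<cdot>,R) - (r - R) \<Gamma>\<close>.\<close>

lemma has_real_derivative_initial_value:
  fixes X X' :: "real \<Rightarrow> real \<Rightarrow> real" and T :: "real \<Rightarrow> ereal"
    and \<kappa> v \<Gamma> \<Gamma>' :: "real \<Rightarrow> real"
  assumes R: "0 < R"
    and \<kappa>: "(\<kappa> has_real_derivative \<kappa>') (at R)" and \<kappa>_R: "0 \<le> \<kappa> R"
    and v: "(v has_real_derivative v') (at R)"
    and T: "\<And>r. 0 < r \<Longrightarrow> 0 < T r"
    and X_0: "\<And>r. 0 < r \<Longrightarrow> X 0 r = r" and X'_0: "\<And>r. 0 < r \<Longrightarrow> X' 0 r = v r"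
    and X: "\<And>r t. 0 < r \<Longrightarrow> 0 \<le> t \<Longrightarrow> ereal t < T r \<Longrightarrow>
      ((\<lambda>t. X t r) has_real_derivative X' t r) (at t within {0..})"
    and X': "\<And>r t. 0 < r \<Longrightarrow> 0 \<le> t \<Longrightarrow> ereal t < T r \<Longrightarrow>
      ((\<lambda>t. X' t r) has_real_derivative \<kappa> r / X t r ^ N) (at t within {0..})"
    and exit: "\<And>r \<tau>. 0 < r \<Longrightarrow> T r = ereal \<tau> \<Longrightarrow> ((\<lambda>t. X t r) \<longlongrightarrow> 0) (at_left \<tau>)"
    and T_R: "T R = \<infinity>" and lower: "\<And>t. 0 \<le> t \<Longrightarrow> R \<le> X t R"
    and \<Gamma>_0: "\<Gamma> 0 = 1" "\<Gamma>' 0 = v'"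
    and \<Gamma>: "\<And>t. 0 \<le> t \<Longrightarrow> (\<Gamma> has_real_derivative \<Gamma>' t) (at t within {0..})"
    and \<Gamma>': "\<And>t. 0 \<le> t \<Longrightarrow>
      (\<Gamma>' has_real_derivative \<kappa>' / X t R ^ N - real N * \<kappa> R * \<Gamma> t / X t R ^ Suc N)
        (at t within {0..})"
    and t: "0 \<le> t"
  shows "((\<lambda>r. X t r) has_real_derivative \<Gamma> t) (at R)"
proof -
  define a where "a = R / 2"
  define G where "G = 1 / a ^ N"
  define L1 where "L1 = real N / a ^ Suc N"
  define L2 where "L2 = real N * (real (Suc N) / a ^ Suc (Suc N))"
  define L where "L = \<kappa> R * L1"
  define K where "K = exp ((2 + L) * t)"
  \<comment> \<open>\<open>B r\<close> is the starting energy of X(.,r) - X(.,R) together with its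
    squared forcing, valid as long as both curves stay above \<open>a\<close>. It tends to 0 as r
    tends to R; \<open>K\<close> is the Gronwall factor up to time t.\<close>
  define B where "B r = (r - R)\<^sup>2 + (v r - v R)\<^sup>2 + (\<bar>\<kappa> r - \<kappa> R\<bar> * G)\<^sup>2" for r
  have a: "0 < a" "a < R" "R - a = R / 2" using R by (auto simp: a_def)
  have pos: "0 \<le> G" "0 \<le> L1" "0 \<le> L2" "0 \<le> L" "1 \<le> K"
    using a t \<kappa>_R by (auto simp: G_def L1_def L2_def L_def K_def)
  have G: "1 / z ^ N \<le> G" "0 \<le> 1 / z ^ N" if "a \<le> z" for z
    using that a by (auto simp: G_def intro!: divide_left_mono power_mono)
  note X_on = has_field_derivative_subset[OF X] has_field_derivative_subset[OF X']
    has_field_derivative_subset[OF \<Gamma>] has_field_derivative_subset[OF \<Gamma>']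
  have close: "(X \<sigma> r - X \<sigma> R)\<^sup>2 \<le> B r * K"
    if r: "0 < r" and \<sigma>: "0 \<le> \<sigma>" "\<sigma> \<le> t" "ereal \<sigma> < T r"
      and above: "\<And>s. s \<in> {0..\<sigma>} \<Longrightarrow> a \<le> X s r" for r \<sigma>
  proof -
    have s_T: "ereal s < T r" if "s \<in> {0..\<sigma>}" for s
      using that \<sigma> by (auto intro: le_less_trans[of _ "ereal \<sigma>"])
    have "(X \<sigma> r - X \<sigma> R)\<^sup>2 \<le> ((X 0 r - X 0 R)\<^sup>2 + (X' 0 r - X' 0 R)\<^sup>2
        + (\<bar>\<kappa> r - \<kappa> R\<bar> * G)\<^sup>2) * exp ((2 + L) * \<sigma>)"
    proof (rule second_order_gronwall)
      fix s assume s: "s \<in> {0..\<sigma>}"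
      show "((\<lambda>s. X s r - X s R) has_real_derivative X' s r - X' s R) (at s within {0..\<sigma>})"
        using s s_T[OF s] r R T_R by (intro DERIV_diff X_on) auto
      show "((\<lambda>s. X' s r - X' s R) has_real_derivative \<kappa> r / X s r ^ N - \<kappa> R / X s R ^ N)
          (at s within {0..\<sigma>})"
        using s s_T[OF s] r R T_R by (intro DERIV_diff X_on) auto
      have "\<kappa> r / X s r ^ N - \<kappa> R / X s R ^ N
          = (\<kappa> r - \<kappa> R) * (1 / X s r ^ N) + \<kappa> R * (1 / X s r ^ N - 1 / X s R ^ N)"
        by (simp add: algebra_simps diff_divide_distrib)
      also have "\<bar>\<dots>\<bar> \<le> \<bar>\<kappa> r - \<kappa> R\<bar> * (1 / X s r ^ N) + \<kappa> R * \<bar>1 / X s r ^ N - 1 / X s R ^ N\<bar>"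
        using \<kappa>_R G[OF above[OF s]]
        by (intro order_trans[OF abs_triangle_ineq]) (simp add: abs_mult)
      also have "\<dots> \<le> \<bar>\<kappa> r - \<kappa> R\<bar> * G + \<kappa> R * (L1 * \<bar>X s r - X s R\<bar>)"
        unfolding L1_def using \<kappa>_R G[OF above[OF s]] above[OF s] lower[of s] s a
        by (intro add_mono mult_left_mono inverse_power_lipschitz) auto
      finally show "\<bar>\<kappa> r / X s r ^ N - \<kappa> R / X s R ^ N\<bar>
          \<le> \<bar>\<kappa> r - \<kappa> R\<bar> * G + L * \<bar>X s r - X s R\<bar>"
        by (simp add: L_def mult.assoc)
    qed (use pos \<sigma> in auto)
    also have "\<dots> = B r * exp ((2 + L) * \<sigma>)"
      using r R by (simp add: B_def X_0 X'_0)
    also have "\<dots> \<le> B r * K"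
      unfolding K_def B_def using pos \<sigma> by (intro mult_left_mono) (auto intro: mult_left_mono)
    finally show ?thesis .
  qed
  have stay: "a \<le> X \<sigma> r"
    if r: "0 < r" "B r * K < (R / 2)\<^sup>2" and \<sigma>: "0 \<le> \<sigma>" "\<sigma> \<le> t" "ereal \<sigma> < T r" for r \<sigma>
  proof (rule ccontr)
    assume "\<not> a \<le> X \<sigma> r"
    have cont: "continuous_on {0..\<sigma>} (\<lambda>s. X s r)"
      using \<sigma> r
      by (intro DERIV_continuous_on[of _ _ "\<lambda>s. X' s r"] X_on(1))
        (auto intro: le_less_trans[of _ "ereal \<sigma>"])
    have "(r - R)\<^sup>2 \<le> B r" by (simp add: B_def)
    also have "B r * 1 \<le> B r * K" using pos by (intro mult_left_mono) (auto simp: B_def)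
    finally have "(r - R)\<^sup>2 < (R / 2)\<^sup>2" using r by simp
    then have "\<bar>r - R\<bar> < R / 2" using R abs_le_square_iff[of "R / 2" "r - R"] by force
    then have "a < r" by (simp add: a_def abs_if split: if_splits)
    \<comment> \<open>At the first time \<open>s0\<close> in \<open>S\<close> the curve is exactly
      at height \<open>a\<close>, and up to then the estimate \<open>close\<close> applies. It puts
      X(s0,r) at distance less than R / 2 from X(s0,R) \<ge> R, which contradicts X(s0,r) = R /
      2.\<close>
    define S where "S = {0..\<sigma>} \<inter> (\<lambda>s. X s r) -` {..a}"
    have "closed S" unfolding S_def by (intro continuous_closed_preimage cont) auto
    moreover have "bounded S" by (rule bounded_subset[of "{0..\<sigma>}"]) (auto simp: S_def)
    moreover have "\<sigma> \<in> S" using \<open>\<not> a \<le> X \<sigma> r\<close> \<sigma> by (auto simp: S_def)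
    ultimately obtain s0 where s0: "s0 \<in> S" and least: "\<And>s. s \<in> S \<Longrightarrow> s0 \<le> s"
      using compact_attains_inf[of S] compact_eq_bounded_closed by blast
    have s0': "0 \<le> s0" "s0 \<le> \<sigma>" "X s0 r \<le> a" using s0 by (auto simp: S_def)
    obtain s where s: "0 \<le> s" "s \<le> s0" "X s r = a"
      using IVT2'[of "\<lambda>s. X s r" s0 a 0] s0' \<open>a < r\<close> r X_0[of r]
        continuous_on_subset[OF cont, of "{0..s0}"] by auto
    then have "s \<in> S" using s0' by (auto simp: S_def)
    then have "X s0 r = a" using least[of s] s by auto
    have "a \<le> X s r" if "s \<in> {0..s0}" for s
      using least[of s] that s0' \<open>X s0 r = a\<close> by (cases "s = s0") (force simp: S_def)+
    then have "(X s0 r - X s0 R)\<^sup>2 \<le> B r * K"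
      using s0' \<sigma> r by (intro close) (auto intro: le_less_trans[of _ "ereal \<sigma>"])
    also have "\<dots> < (R / 2)\<^sup>2" by (rule r)
    finally have "\<bar>X s0 r - X s0 R\<bar> < R / 2"
      using R abs_le_square_iff[of "R / 2" "X s0 r - X s0 R"] by force
    then show False using lower[of s0] s0' \<open>X s0 r = a\<close> a by auto
  qed
  have alive: "ereal t < T r" if r: "0 < r" "B r * K < (R / 2)\<^sup>2" for r
  proof (rule ccontr)
    assume "\<not> ereal t < T r"
    then obtain \<tau> where \<tau>: "T r = ereal \<tau>" "0 < \<tau>" "\<tau> \<le> t"
      using T[OF r(1)] by (cases "T r") auto
    have "eventually (\<lambda>s. s \<in> {0<..<\<tau>}) (at_left \<tau>)"
      using \<tau> by (intro eventually_at_left_real) auto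
    then have "eventually (\<lambda>s. a \<le> X s r) (at_left \<tau>)"
      by eventually_elim (use \<tau> r in \<open>auto intro!: stay\<close>)
    then have "a \<le> 0" using exit[OF r(1) \<tau>(1)] by (intro tendsto_lowerbound) auto
    with a show False by simp
  qed
  \<comment> \<open>\<open>Q\<close> is \<open>B\<close> divided by (r - R)^2, hence bounded near R,
    and \<open>D\<close> is the resulting bound for |X(s,r) - X(s,R)|. After division by |r - R|,
    \<open>H\<close> is the forcing of the remainder and \<open>U\<close> bounds the square of the
    remainder; both tend to 0.\<close>
  define Q where "Q r = 1 + ((v r - v R) / (r - R))\<^sup>2 + ((\<kappa> r - \<kappa> R) / (r - R) * G)\<^sup>2" for r
  define D where "D r = \<bar>r - R\<bar> * sqrt (Q r * K)" for r
  define H where "H r = \<bar>(\<kappa> r - \<kappa> R) / (r - R) - \<kappa>'\<bar> * G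
      + \<bar>(\<kappa> r - \<kappa> R) / (r - R)\<bar> * L1 * D r + \<kappa> R * L2 * D r * sqrt (Q r * K)" for r
  define U where "U r = (((v r - v R) / (r - R) - v')\<^sup>2 + (H r)\<^sup>2) * K" for r
  have Q: "0 \<le> Q r" for r by (simp add: Q_def)
  have BQ: "B r = (r - R)\<^sup>2 * Q r" if "r \<noteq> R" for r
    using that by (simp add: B_def Q_def distrib_left power_mult_distrib power_divide)
  have estimate: "((X t r - X t R) / (r - R) - \<Gamma> t)\<^sup>2 \<le> U r"
    if r: "0 < r" "B r * K < (R / 2)\<^sup>2" "r \<noteq> R" for r
  proof -
    have s_T: "ereal s < T r" if "s \<in> {0..t}" for s
      using that alive[OF r(1,2)] by (auto intro: le_less_trans[of _ "ereal t"])
    have above: "a \<le> X s r" if "s \<in> {0..t}" for s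
      using that by (intro stay r s_T) auto
    have dist: "\<bar>X s r - X s R\<bar> \<le> D r" if "s \<in> {0..t}" for s
    proof -
      have "(X s r - X s R)\<^sup>2 \<le> B r * K"
        using that by (intro close r s_T above) auto
      also have "\<dots> = (D r)\<^sup>2"
        using r pos Q by (simp add: D_def BQ power_mult_distrib)
      finally show ?thesis
        using abs_le_square_iff[of "X s r - X s R" "D r"] pos Q by (simp add: D_def)
    qed
    have D: "0 \<le> D r" using pos Q by (simp add: D_def)
    have "(X t r - X t R - (r - R) * \<Gamma> t)\<^sup>2
        \<le> ((X 0 r - X 0 R - (r - R) * \<Gamma> 0)\<^sup>2 + (X' 0 r - X' 0 R - (r - R) * \<Gamma>' 0)\<^sup>2
          + (\<bar>r - R\<bar> * H r)\<^sup>2) * exp ((2 + L) * t)"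
    proof (rule second_order_gronwall)
      fix s assume s: "s \<in> {0..t}"
      let ?z = "X s r" and ?x = "X s R"
      let ?e'' = "\<kappa> r / ?z ^ N - \<kappa> R / ?x ^ N
          - (r - R) * (\<kappa>' / ?x ^ N - real N * \<kappa> R * \<Gamma> s / ?x ^ Suc N)"
      show "((\<lambda>s. X s r - X s R - (r - R) * \<Gamma> s) has_real_derivative
          X' s r - X' s R - (r - R) * \<Gamma>' s) (at s within {0..t})"
        using s s_T[OF s] r R T_R by (intro DERIV_diff DERIV_cmult X_on) auto
      show "((\<lambda>s. X' s r - X' s R - (r - R) * \<Gamma>' s) has_real_derivative ?e'') (at s within {0..t})"
        using s s_T[OF s] r R T_R by (intro DERIV_diff DERIV_cmult X_on) auto
      have x: "a \<le> ?x" "R \<le> ?x" using lower[of s] s a by auto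
      \<comment> \<open>\<open>p\<close> carries the first-order remainder of \<kappa>,
        \<open>q\<close> the product of two increments, \<open>u\<close> the Taylor remainder of the
        inverse power. These must be o(|r - R|) uniformly in s. Only \<open>w\<close> contains the
        unknown remainder itself; it produces the constant L of Gronwall's inequality.\<close>
      define p where "p = (\<kappa> r - \<kappa> R - (r - R) * \<kappa>') * (1 / ?x ^ N)"
      define q where "q = (\<kappa> r - \<kappa> R) * (1 / ?z ^ N - 1 / ?x ^ N)"
      define u where "u = \<kappa> R * (1 / ?z ^ N - 1 / ?x ^ N + real N / ?x ^ Suc N * (?z - ?x))"
      define w where "w = \<kappa> R * (real N / ?x ^ Suc N) * (?z - ?x - (r - R) * \<Gamma> s)"
      have "?e'' = p + q + u - w"
        unfolding p_def q_def u_def w_def by (simp add: algebra_simps diff_divide_distrib add_divide_distrib)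
      then have "\<bar>?e''\<bar> \<le> \<bar>p\<bar> + \<bar>q\<bar> + \<bar>u\<bar> + \<bar>w\<bar>"
        by linarith
      moreover have "\<bar>p\<bar> \<le> \<bar>r - R\<bar> * (\<bar>(\<kappa> r - \<kappa> R) / (r - R) - \<kappa>'\<bar> * G)"
      proof -
        have "\<bar>p\<bar> = \<bar>\<kappa> r - \<kappa> R - (r - R) * \<kappa>'\<bar> * (1 / ?x ^ N)"
          using G[OF x(1)] by (simp add: p_def abs_mult)
        also have "\<bar>\<kappa> r - \<kappa> R - (r - R) * \<kappa>'\<bar> = \<bar>r - R\<bar> * \<bar>(\<kappa> r - \<kappa> R) / (r - R) - \<kappa>'\<bar>"
          using r(3) by (simp add: field_simps flip: abs_mult)
        finally show ?thesis
          using mult_left_mono[OF G(1)[OF x(1)], of "\<bar>r - R\<bar> * \<bar>(\<kappa> r - \<kappa> R) / (r - R) - \<kappa>'\<bar>"]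
          by (simp add: mult.assoc)
      qed
      moreover have "\<bar>q\<bar> \<le> \<bar>r - R\<bar> * (\<bar>(\<kappa> r - \<kappa> R) / (r - R)\<bar> * L1 * D r)"
      proof -
        have "\<bar>q\<bar> \<le> \<bar>\<kappa> r - \<kappa> R\<bar> * (L1 * \<bar>?z - ?x\<bar>)"
          unfolding q_def L1_def abs_mult
          by (intro mult_left_mono inverse_power_lipschitz a x above[OF s]) auto
        also have "\<dots> \<le> \<bar>\<kappa> r - \<kappa> R\<bar> * (L1 * D r)"
          using pos dist[OF s] by (intro mult_left_mono) auto
        also have "\<bar>\<kappa> r - \<kappa> R\<bar> = \<bar>r - R\<bar> * \<bar>(\<kappa> r - \<kappa> R) / (r - R)\<bar>"
          using r(3) by (simp add: field_simps flip: abs_mult)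
        finally show ?thesis by (simp only: mult.assoc)
      qed
      moreover have "\<bar>u\<bar> \<le> \<bar>r - R\<bar> * (\<kappa> R * L2 * D r * sqrt (Q r * K))"
      proof -
        have "\<bar>u\<bar> \<le> \<kappa> R * (L2 * (?z - ?x)\<^sup>2)"
          unfolding u_def L2_def abs_mult using \<kappa>_R
          by (intro mult_mono inverse_power_taylor a x above[OF s]) auto
        also have "\<dots> \<le> \<kappa> R * (L2 * (D r)\<^sup>2)"
          using dist[OF s] D pos \<kappa>_R
          by (intro mult_left_mono) (auto simp: abs_le_square_iff[symmetric])
        \<comment> \<open>One factor \<open>D r\<close> releases |r - R|; the other is kept because
          it still tends to 0.\<close>
        also have "(D r)\<^sup>2 = \<bar>r - R\<bar> * (D r * sqrt (Q r * K))"
          by (simp add: D_def power2_eq_square)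
        finally show ?thesis by (simp add: algebra_simps)
      qed
      moreover have "\<bar>w\<bar> \<le> L * \<bar>?z - ?x - (r - R) * \<Gamma> s\<bar>"
      proof -
        have "\<bar>w\<bar> = \<kappa> R * (real N / ?x ^ Suc N) * \<bar>?z - ?x - (r - R) * \<Gamma> s\<bar>"
          unfolding w_def abs_mult using \<kappa>_R x R by simp
        also have "\<kappa> R * (real N / ?x ^ Suc N) \<le> L"
          unfolding L_def L1_def using \<kappa>_R x a
          by (intro mult_left_mono divide_left_mono power_mono) auto
        finally show ?thesis by (simp add: mult_right_mono)
      qed
      ultimately show "\<bar>?e''\<bar> \<le> \<bar>r - R\<bar> * H r + L * \<bar>?z - ?x - (r - R) * \<Gamma> s\<bar>"
        unfolding H_def distrib_left by argo
    qed (use pos t in auto)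
    also have "\<dots> = (r - R)\<^sup>2 * U r"
    proof -
      have "v r - v R - (r - R) * v' = (r - R) * ((v r - v R) / (r - R) - v')"
        using r(3) by (simp add: field_simps)
      then have "(X' 0 r - X' 0 R - (r - R) * \<Gamma>' 0)\<^sup>2 = (r - R)\<^sup>2 * ((v r - v R) / (r - R) - v')\<^sup>2"
        using r R \<Gamma>_0 by (simp add: X'_0 power_mult_distrib)
      moreover have "(X 0 r - X 0 R - (r - R) * \<Gamma> 0)\<^sup>2 = 0"
        using r R \<Gamma>_0 by (simp add: X_0)
      ultimately show ?thesis
        by (simp add: U_def K_def power_mult_distrib algebra_simps)
    qed
    also have "(X t r - X t R - (r - R) * \<Gamma> t)\<^sup>2 = (r - R)\<^sup>2 * ((X t r - X t R) / (r - R) - \<Gamma> t)\<^sup>2"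
      using r(3) by (simp add: field_simps flip: power_mult_distrib)
    finally show ?thesis using r(3) by simp
  qed
  have \<kappa>_lim: "((\<lambda>r. (\<kappa> r - \<kappa> R) / (r - R)) \<longlongrightarrow> \<kappa>') (at R)"
    and v_lim: "((\<lambda>r. (v r - v R) / (r - R)) \<longlongrightarrow> v') (at R)"
    using \<kappa> v by (simp_all add: has_field_derivative_iff)
  have Q_lim: "(Q \<longlongrightarrow> 1 + v'\<^sup>2 + (\<kappa>' * G)\<^sup>2) (at R)"
    unfolding Q_def by (intro tendsto_intros \<kappa>_lim v_lim)
  have "(D \<longlongrightarrow> \<bar>R - R\<bar> * sqrt ((1 + v'\<^sup>2 + (\<kappa>' * G)\<^sup>2) * K)) (at R)"
    unfolding D_def by (intro tendsto_intros Q_lim)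
  then have D_lim: "(D \<longlongrightarrow> 0) (at R)" by simp
  have "(H \<longlongrightarrow> \<bar>\<kappa>' - \<kappa>'\<bar> * G + \<bar>\<kappa>'\<bar> * L1 * 0
      + \<kappa> R * L2 * 0 * sqrt ((1 + v'\<^sup>2 + (\<kappa>' * G)\<^sup>2) * K)) (at R)"
    unfolding H_def by (intro tendsto_intros Q_lim D_lim \<kappa>_lim)
  then have H_lim: "(H \<longlongrightarrow> 0) (at R)" by simp
  have "(U \<longlongrightarrow> ((v' - v')\<^sup>2 + 0\<^sup>2) * K) (at R)"
    unfolding U_def by (intro tendsto_intros H_lim v_lim)
  then have U_lim: "(U \<longlongrightarrow> 0) (at R)" by simp
  have "(\<kappa> \<longlongrightarrow> \<kappa> R) (at R)" "(v \<longlongrightarrow> v R) (at R)"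
    using \<kappa> v by (auto dest: DERIV_isCont simp: isCont_def)
  then have "((\<lambda>r. B r * K) \<longlongrightarrow> ((R - R)\<^sup>2 + (v R - v R)\<^sup>2 + (\<bar>\<kappa> R - \<kappa> R\<bar> * G)\<^sup>2) * K) (at R)"
    unfolding B_def by (intro tendsto_intros)
  then have "eventually (\<lambda>r. B r * K < (R / 2)\<^sup>2) (at R)"
    using R by (intro order_tendstoD) auto
  moreover have "eventually (\<lambda>r. 0 < r) (at R)"
    using R by (intro order_tendstoD(1)[OF tendsto_ident_at]) auto
  moreover have "eventually (\<lambda>r. r \<noteq> R) (at R)"
    by (simp add: eventually_at_filter)
  ultimately have "eventually (\<lambda>r. ((X t r - X t R) / (r - R) - \<Gamma> t)\<^sup>2 \<le> U r) (at R)"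
    by eventually_elim (rule estimate)
  then have "((\<lambda>r. ((X t r - X t R) / (r - R) - \<Gamma> t)\<^sup>2) \<longlongrightarrow> 0) (at R)"
    by (intro tendsto_sandwich[OF _ _ tendsto_const U_lim]) auto
  then have "((\<lambda>r. sqrt (((X t r - X t R) / (r - R) - \<Gamma> t)\<^sup>2)) \<longlongrightarrow> sqrt 0) (at R)"
    by (rule tendsto_real_sqrt)
  then have "((\<lambda>r. (X t r - X t R) / (r - R) - \<Gamma> t) \<longlongrightarrow> 0) (at R)"
    by (simp add: tendsto_rabs_zero_iff)
  then show ?thesis
    unfolding has_field_derivative_iff by (rule LIM_zero_cancel)
qed

section \<open>The tail integral\<close>

text \<open>The modification at \<open>y \<le> 1\<close> removes the junk value \<open>-1\<close> of the integrand at \<open>y = 1\<close>. The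
  majorant is the integrand for \<open>n = 4\<close>, which has an elementary antiderivative.\<close>

definition tail_integrand :: "nat \<Rightarrow> real \<Rightarrow> real" where
  "tail_integrand n y = (if y \<le> 1 then 0 else (1 - 1 / y\<^sup>2) powr (- (1 / (real n - 2))) - 1)"

definition tail_majorant :: "real \<Rightarrow> real" where
  "tail_majorant y = (if y \<le> 1 then 0 else y / sqrt (y\<^sup>2 - 1) - 1)"

lemma tail_integral_eq:
  assumes "1 \<le> a"
  shows "tail_integral n a = integral {a..} (tail_integrand n)"
  unfolding tail_integral_def
  by (rule integral_spike[of "{1}"]) (use assms in \<open>auto simp: tail_integrand_def\<close>)

text \<open>The base lies in (0,1) and 0 < 1 / (n - 2) < 1/2, so the power lies between those with
  exponents 0 and -1/2. The strict version is what later yields I_n < 1.\<close>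

lemma tail_integrand_bounds:
  assumes "5 \<le> n"
  shows "0 \<le> tail_integrand n y" "tail_integrand n y \<le> tail_majorant y"
    and "1 < y \<Longrightarrow> tail_integrand n y < tail_majorant y"
proof -
  have *: "0 \<le> tail_integrand n y \<and> tail_integrand n y < tail_majorant y" if y: "1 < y"
  proof -
    let ?u = "1 - 1 / y\<^sup>2"
    have u: "0 < ?u" "?u < 1" using y by (auto simp: field_simps)
    have "?u powr (- (1 / (real n - 2))) < ?u powr (- (1 / 2))"
      using u assms by (intro powr_less_mono') (auto simp: field_simps)
    also have "\<dots> = y / sqrt (y\<^sup>2 - 1)"
    proof -
      have "sqrt ?u = sqrt (y\<^sup>2 - 1) / y"
        using y by (simp add: field_simps real_sqrt_divide flip: real_sqrt_mult)
      then show ?thesis using u by (simp add: powr_minus powr_half_sqrt)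
    qed
    finally have "?u powr (- (1 / (real n - 2))) < y / sqrt (y\<^sup>2 - 1)" .
    moreover have "1 = ?u powr 0" using u by simp
    moreover have "?u powr 0 \<le> ?u powr (- (1 / (real n - 2)))"
      using u assms by (intro powr_mono') auto
    ultimately show ?thesis using y by (simp add: tail_integrand_def tail_majorant_def)
  qed
  then show "0 \<le> tail_integrand n y" "tail_integrand n y \<le> tail_majorant y"
    by (cases "1 < y"; simp add: tail_integrand_def tail_majorant_def less_imp_le)+
  show "1 < y \<Longrightarrow> tail_integrand n y < tail_majorant y" using * by blast
qed

lemma DERIV_sqrt_square_minus_1:
  fixes y :: real
  assumes "1 < y"
  shows "((\<lambda>y. sqrt (y\<^sup>2 - 1)) has_real_derivative y / sqrt (y\<^sup>2 - 1)) (at y)"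
proof -
  have "0 < y\<^sup>2 - 1" using assms by (simp add: abs_square_less_1 one_less_power)
  then have "(sqrt has_real_derivative inverse (sqrt (y\<^sup>2 - 1)) / 2) (at (y\<^sup>2 - 1))"
    by (rule DERIV_real_sqrt)
  moreover have "((\<lambda>y. y\<^sup>2 - 1) has_real_derivative 2 * y) (at y)"
    by (auto intro!: derivative_eq_intros)
  ultimately have "((\<lambda>y. sqrt (y\<^sup>2 - 1)) has_real_derivative inverse (sqrt (y\<^sup>2 - 1)) / 2 * (2 * y)) (at y)"
    by (rule DERIV_chain2)
  then show ?thesis by (simp add: field_simps)
qed

lemma has_integral_tail_majorant:
  assumes a: "1 \<le> a"
  shows "(tail_majorant has_integral a - sqrt (a\<^sup>2 - 1)) {a..}"
proof -
  define F where "F y = sqrt (y\<^sup>2 - 1) - y" for y :: real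
  \<comment> \<open>For a = 1 the antiderivative is continuous but not differentiable at the left
    endpoint, hence the interior form of the fundamental theorem.\<close>
  have F: "(tail_majorant has_integral F b - F a) {a..b}" if "a \<le> b" for b
  proof (rule fundamental_theorem_of_calculus_interior[OF that])
    show "continuous_on {a..b} F" unfolding F_def by (intro continuous_intros)
    fix y assume "y \<in> {a<..<b}"
    then have y: "1 < y" using a by auto
    then have "(F has_real_derivative tail_majorant y) (at y)"
      using DERIV_diff[OF DERIV_sqrt_square_minus_1 DERIV_ident]
      by (simp add: F_def[abs_def] tail_majorant_def)
    then show "(F has_vector_derivative tail_majorant y) (at y)"
      by (simp add: has_real_derivative_iff_has_vector_derivative)
  qed
  show ?thesis
  proof (rule has_integral_to_inf)
    show "tail_majorant integrable_on {a..b}" for b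
      using F[of b] by (cases "a \<le> b") (auto simp: integrable_on_def)
    have "((\<lambda>b. F b - F a) \<longlongrightarrow> 0 - F a) at_top"
      unfolding F_def by (intro tendsto_diff tendsto_const) real_asymp
    moreover have "\<forall>\<^sub>F b in at_top. F b - F a = integral {a..b} tail_majorant"
      using F by (intro eventually_at_top_linorderI[of a]) (rule integral_unique[symmetric])
    ultimately show "((\<lambda>b. integral {a..b} tail_majorant) \<longlongrightarrow> a - sqrt (a\<^sup>2 - 1)) at_top"
      by (auto simp: F_def intro: Lim_transform_eventually)
    \<comment> \<open>The index 5 is just some admissible dimension: the majorant dominates a
      nonnegative function.\<close>
    show "0 \<le> tail_majorant y" if "y \<ge> a" for y
      using order_trans[OF tail_integrand_bounds(1,2)[of 5 y]] by simp
  qed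
qed

lemma tail_integrand_integrable:
  assumes "5 \<le> n" "1 \<le> a"
  shows "tail_integrand n integrable_on {a..}" "tail_integrand n integrable_on {a..b}"
proof -
  have "tail_integrand n \<in> borel_measurable borel"
    unfolding tail_integrand_def[abs_def] by measurable
  then have "tail_integrand n \<in> borel_measurable (lebesgue_on {a..})"
    by (intro measurable_restrict_space1 measurable_completion) simp
  then show *: "tail_integrand n integrable_on {a..}"
  proof (rule measurable_bounded_by_integrable_imp_integrable_real)
    show "tail_majorant integrable_on {a..}"
      using has_integral_tail_majorant[OF assms(2)] by (rule has_integral_integrable)
    show "\<bar>tail_integrand n y\<bar> \<le> tail_majorant y" for y
      using tail_integrand_bounds[OF assms(1), of y] by simp
  qed simp
  show "tail_integrand n integrable_on {a..b}"
    by (rule integrable_on_subinterval[OF *]) auto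
qed

lemma tail_integral_split:
  assumes "5 \<le> n" "1 \<le> a" "a \<le> b"
  shows "tail_integral n b = tail_integral n a - integral {a..b} (tail_integrand n)"
proof -
  have "integral ({a..b} \<union> {b..}) (tail_integrand n)
      = integral {a..b} (tail_integrand n) + integral {b..} (tail_integrand n)"
    using assms by (intro integral_Un tail_integrand_integrable) (auto simp: negligible_subset[of "{b}"])
  moreover have "{a..b} \<union> {b..} = {a..}" using assms by auto
  ultimately show ?thesis using assms by (simp add: tail_integral_eq)
qed

lemma tail_integral_bounds:
  assumes "5 \<le> n" "1 \<le> a"
  shows "0 \<le> tail_integral n a" "tail_integral n a \<le> a - sqrt (a\<^sup>2 - 1)"
proof -
  note int = tail_integrand_integrable(1)[OF assms]
  show "0 \<le> tail_integral n a"
    unfolding tail_integral_eq[OF assms(2)] using tail_integrand_bounds(1)[OF assms(1)]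
    by (intro integral_nonneg int)
  show "tail_integral n a \<le> a - sqrt (a\<^sup>2 - 1)"
    unfolding tail_integral_eq[OF assms(2)] using tail_integrand_bounds(2)[OF assms(1)]
    by (rule has_integral_le[OF integrable_integral[OF int] has_integral_tail_majorant[OF assms(2)]])
qed

lemma tail_integral_at_top:
  assumes "5 \<le> n"
  shows "(tail_integral n \<longlongrightarrow> 0) at_top"
proof (rule tendsto_sandwich)
  show "\<forall>\<^sub>F a in at_top. 0 \<le> tail_integral n a"
    "\<forall>\<^sub>F a in at_top. tail_integral n a \<le> a - sqrt (a\<^sup>2 - 1)"
    using tail_integral_bounds[OF assms] by (auto intro: eventually_at_top_linorderI[of 1])
  show "((\<lambda>a. a - sqrt (a\<^sup>2 - 1)) \<longlongrightarrow> 0) at_top" by real_asymp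
qed auto

lemma tail_integral_deriv:
  assumes n: "5 \<le> n" and a: "1 < a"
  shows "(tail_integral n has_real_derivative - ((1 - 1 / a\<^sup>2) powr (- (1 / (real n - 2))) - 1)) (at a)"
proof -
  \<comment> \<open>The integrand is unbounded near 1, so the base point of the indefinite integral
    is put strictly between 1 and a.\<close>
  define c where "c = (1 + a) / 2"
  have c: "1 < c" "c < a" using a by (auto simp: c_def)
  have "continuous_on {c..a+1} (\<lambda>y. (1 - 1 / y\<^sup>2) powr (- (1 / (real n - 2))) - 1)"
    using c by (intro continuous_intros) (auto simp: power2_eq_1_iff)
  then have "continuous_on {c..a+1} (tail_integrand n)"
    using c by (subst continuous_on_cong[OF refl]) (auto simp: tail_integrand_def)
  then have "((\<lambda>y. integral {c..y} (tail_integrand n)) has_real_derivative tail_integrand n a)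
      (at a within {c..a+1})"
    using c by (intro integral_has_real_derivative) auto
  then have "((\<lambda>y. integral {c..y} (tail_integrand n)) has_real_derivative tail_integrand n a) (at a)"
    using c by (simp add: at_within_Icc_at)
  then have "((\<lambda>y. tail_integral n c - integral {c..y} (tail_integrand n))
      has_real_derivative 0 - tail_integrand n a) (at a)"
    by (intro derivative_intros)
  moreover have "eventually (\<lambda>y. tail_integral n c - integral {c..y} (tail_integrand n) = tail_integral n y) (nhds a)"
    by (rule eventually_mono[OF eventually_nhds_in_open[of "{c<..}"]])
      (use c in \<open>auto intro!: tail_integral_split[OF n, symmetric]\<close>)
  ultimately have "(tail_integral n has_real_derivative 0 - tail_integrand n a) (at a)"
    by (subst DERIV_cong_ev[OF refl _ refl, symmetric])
  then show ?thesis using a by (simp add: tail_integrand_def)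
qed

lemma continuous_on_tail_integral:
  assumes n: "5 \<le> n"
  shows "continuous_on {1..b} (tail_integral n)"
proof -
  have "continuous_on {1..b} (\<lambda>y. tail_integral n 1 - integral {1..y} (tail_integrand n))"
    by (intro continuous_intros indefinite_integral_continuous_1 tail_integrand_integrable n) simp
  then show ?thesis
    by (rule continuous_on_eq) (auto intro!: tail_integral_split[OF n, symmetric])
qed

text \<open>The majorant has integral exactly 1 over [1, \<infinity>). \<open>D a\<close> is its
  surplus over the integrand beyond a: nonnegative at 2 and strictly decreasing on [1,2], hence
  positive at 1. The point 2 is arbitrary.\<close>

lemma tail_integral_1_less:
  assumes n: "5 \<le> n"
  shows "tail_integral n 1 < 1"
proof -
  define D where "D a = a - sqrt (a\<^sup>2 - 1) - tail_integral n a" for a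
  have "D 2 < D 1"
  proof (rule DERIV_neg_imp_decreasing_open[of 1 2 D])
    show "continuous_on {1..2} D"
      unfolding D_def by (intro continuous_intros continuous_on_tail_integral n)
    fix a :: real assume a: "1 < a" "a < 2"
    have "(D has_real_derivative 1 - a / sqrt (a\<^sup>2 - 1)
        - - ((1 - 1 / a\<^sup>2) powr (- (1 / (real n - 2))) - 1)) (at a)"
      unfolding D_def using a
      by (intro DERIV_diff DERIV_ident DERIV_sqrt_square_minus_1 tail_integral_deriv n)
    then have "(D has_real_derivative tail_integrand n a - tail_majorant a) (at a)"
      using a by (simp add: tail_integrand_def tail_majorant_def)
    then show "\<exists>y. (D has_real_derivative y) (at a) \<and> y < 0"
      using tail_integrand_bounds(3)[OF n a(1)] by (intro exI[of _ "tail_integrand n a - tail_majorant a"]) auto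
  qed simp
  moreover have "0 \<le> D 2" using tail_integral_bounds[OF n, of 2] by (simp add: D_def)
  ultimately show ?thesis by (simp add: D_def)
qed

section \<open>The normalized trajectory\<close>

text \<open>The factor p / 2 in the force normalizes the conserved energy: \<xi>'^2 + 1 / \<xi>^p =
  1, so the limiting speed is 1 and 1 / \<xi>' can serve as a variable in (1, \<infinity>).\<close>

locale radial_profile =
  fixes p :: nat and \<xi> \<xi>' :: "real \<Rightarrow> real"
  assumes p: "1 \<le> p"
    and init: "\<xi> 0 = 1" "\<xi>' 0 = 0"
    and pos: "\<And>\<tau>. 0 \<le> \<tau> \<Longrightarrow> 0 < \<xi> \<tau>"
    and \<xi>_deriv: "\<And>\<tau>. 0 \<le> \<tau> \<Longrightarrow> (\<xi> has_real_derivative \<xi>' \<tau>) (at \<tau> within {0..})"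
    and \<xi>'_deriv: "\<And>\<tau>. 0 \<le> \<tau> \<Longrightarrow>
      (\<xi>' has_real_derivative real p / (2 * \<xi> \<tau> ^ Suc p)) (at \<tau> within {0..})"
begin

lemma deriv_at:
  assumes "0 < \<tau>"
  shows "(\<xi> has_real_derivative \<xi>' \<tau>) (at \<tau>)"
    and "(\<xi>' has_real_derivative real p / (2 * \<xi> \<tau> ^ Suc p)) (at \<tau>)"
  using \<xi>_deriv[of \<tau>] \<xi>'_deriv[of \<tau>] assms at_within_interior[of \<tau> "{0..}"] by auto

lemma cont:
  assumes "0 \<le> a"
  shows "continuous_on {a..b} \<xi>" "continuous_on {a..b} \<xi>'"
proof -
  have "continuous_on {0..} \<xi>" "continuous_on {0..} \<xi>'"
    using DERIV_continuous_on[of "{0..}", OF \<xi>_deriv] DERIV_continuous_on[of "{0..}", OF \<xi>'_deriv]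
    by auto
  then show "continuous_on {a..b} \<xi>" "continuous_on {a..b} \<xi>'"
    using assms by (auto elim!: continuous_on_subset)
qed

lemma \<xi>'_strict_mono:
  assumes "0 \<le> a" "a < b"
  shows "\<xi>' a < \<xi>' b"
proof (rule DERIV_pos_imp_increasing_open[OF assms(2)])
  fix s assume "a < s" "s < b"
  then show "\<exists>y. (\<xi>' has_real_derivative y) (at s) \<and> 0 < y"
    using assms p pos[of s] by (intro exI[of _ "real p / (2 * \<xi> s ^ Suc p)"] conjI deriv_at(2)) auto
qed (rule cont(2)[OF assms(1)])

lemma \<xi>'_pos: "0 < \<tau> \<Longrightarrow> 0 < \<xi>' \<tau>"
  using \<xi>'_strict_mono[of 0 \<tau>] init by simp

lemma \<xi>_strict_mono:
  assumes "0 \<le> a" "a < b"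
  shows "\<xi> a < \<xi> b"
proof (rule DERIV_pos_imp_increasing_open[OF assms(2)])
  fix s assume "a < s" "s < b"
  then show "\<exists>y. (\<xi> has_real_derivative y) (at s) \<and> 0 < y"
    using assms \<xi>'_pos[of s] by (intro exI[of _ "\<xi>' s"] conjI deriv_at(1)) auto
qed (rule cont(1)[OF assms(1)])

lemma \<xi>_gt_1: "0 < \<tau> \<Longrightarrow> 1 < \<xi> \<tau>"
  using \<xi>_strict_mono[of 0 \<tau>] init by simp

lemma energy:
  assumes "0 \<le> \<tau>"
  shows "(\<xi>' \<tau>)\<^sup>2 = 1 - 1 / \<xi> \<tau> ^ p"
proof -
  define E where "E s = (\<xi>' s)\<^sup>2 + 1 / \<xi> s ^ p" for s
  have "E \<tau> = E 0"
  proof (cases "\<tau> = 0")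
    case False
    then have "0 < \<tau>" using assms by simp
    then show ?thesis
    proof (rule DERIV_isconst_end)
      have "\<xi> s \<noteq> 0" if "s \<in> {0..\<tau>}" for s using pos[of s] that by auto
      then show "continuous_on {0..\<tau>} E"
        unfolding E_def by (intro continuous_intros cont) auto
      fix s assume s: "0 < s" "s < \<tau>"
      have "(E has_real_derivative
          (2 * \<xi>' s) * (real p / (2 * \<xi> s ^ Suc p)) + - (real p / \<xi> s ^ Suc p) * \<xi>' s) (at s)"
        unfolding E_def using s pos[of s]
        by (intro DERIV_add DERIV_chain2[OF inverse_power_deriv deriv_at(1)])
          (auto intro!: derivative_eq_intros deriv_at(2) simp: power2_eq_square)
      then show "(E has_real_derivative 0) (at s)" by (simp add: field_simps)
    qed
  qed simp
  then show ?thesis by (simp add: E_def init)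
qed

text \<open>Convexity: the tangent at \<tau> lies below the graph at 0. This controls (\<xi> - 1) /
  \<xi>' near 0 and, with \<xi>' < 1, gives at most linear growth.\<close>

lemma \<xi>_le: "0 \<le> \<tau> \<Longrightarrow> \<xi> \<tau> \<le> 1 + \<tau> * \<xi>' \<tau>"
proof (cases "\<tau> = 0")
  case False
  assume "0 \<le> \<tau>"
  with False have \<tau>: "0 < \<tau>" by simp
  obtain s where s: "0 < s" "s < \<tau>" "\<xi> \<tau> - \<xi> 0 = (\<tau> - 0) * \<xi>' s"
    using MVT2[OF \<tau>, of \<xi> \<xi>'] MVT[OF \<tau> cont(1)] deriv_at
    by (metis DERIV_unique real_differentiable_def order_refl)
  have "\<xi> \<tau> = 1 + \<tau> * \<xi>' s" using s init by simp
  moreover have "\<tau> * \<xi>' s \<le> \<tau> * \<xi>' \<tau>" using \<xi>'_strict_mono[of s \<tau>] s \<tau> by simp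
  ultimately show ?thesis by linarith
qed (simp add: init)

lemma \<xi>'_less_1:
  assumes "0 \<le> \<tau>"
  shows "\<xi>' \<tau> < 1"
proof -
  have "(\<xi>' \<tau>)\<^sup>2 < 1\<^sup>2" using energy[OF assms] pos[OF assms] by simp
  then show ?thesis by (rule power_less_imp_less_base) simp
qed

lemma \<xi>_at_top: "filterlim \<xi> at_top at_top"
proof (rule filterlim_at_top_mono)
  show "filterlim (\<lambda>\<tau>. \<xi>' 1 * (\<tau> - 1)) at_top at_top"
  proof (rule filterlim_tendsto_pos_mult_at_top[OF tendsto_const])
    show "filterlim (\<lambda>\<tau>::real. \<tau> - 1) at_top at_top" by real_asymp
  qed (simp add: \<xi>'_pos)
  have "\<xi>' 1 * (\<tau> - 1) \<le> \<xi> \<tau>" if \<tau>: "1 < \<tau>" for \<tau>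
  proof -
    obtain s where s: "1 < s" "s < \<tau>" "\<xi> \<tau> - \<xi> 1 = (\<tau> - 1) * \<xi>' s"
      using MVT2[OF \<tau>, of \<xi> \<xi>'] deriv_at(1) by auto
    then have "(\<tau> - 1) * \<xi>' 1 \<le> (\<tau> - 1) * \<xi>' s" using \<xi>'_strict_mono[of 1 s] by simp
    then have "(\<tau> - 1) * \<xi>' 1 \<le> \<xi> \<tau>" using s(3) pos[OF zero_le_one] by linarith
    then show ?thesis by (simp only: mult.commute)
  qed
  then show "\<forall>\<^sub>F \<tau> in at_top. \<xi>' 1 * (\<tau> - 1) \<le> \<xi> \<tau>"
    using eventually_gt_at_top[of 1] by (rule eventually_mono[rotated])
qed

section \<open>The crossing function: blow-up at 0, monotonicity and attained values\<close>

definition crossing :: "real \<Rightarrow> real \<Rightarrow> real" where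
  "crossing h \<tau> = \<xi> \<tau> / \<xi>' \<tau> - (1 - h) * \<tau>"

lemma crossing_deriv:
  assumes \<tau>: "0 < \<tau>"
  shows "(crossing h has_real_derivative h - real p / (2 * (\<xi> \<tau> ^ p - 1))) (at \<tau>)"
proof -
  note d = deriv_at[OF \<tau>]
  have x: "0 < \<xi> \<tau>" "1 < \<xi> \<tau> ^ p" "\<xi>' \<tau> \<noteq> 0"
    using \<xi>_gt_1[OF \<tau>] \<xi>'_pos[OF \<tau>] p one_less_power[of "\<xi> \<tau>" p] by auto
  have "(crossing h has_real_derivative
      (\<xi>' \<tau> * \<xi>' \<tau> - \<xi> \<tau> * (real p / (2 * \<xi> \<tau> ^ Suc p))) / (\<xi>' \<tau> * \<xi>' \<tau>) - (1 - h) * 1) (at \<tau>)"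
    unfolding crossing_def using x by (intro DERIV_diff DERIV_divide d DERIV_cmult DERIV_ident) auto
  also have "(\<xi>' \<tau> * \<xi>' \<tau> - \<xi> \<tau> * (real p / (2 * \<xi> \<tau> ^ Suc p))) / (\<xi>' \<tau> * \<xi>' \<tau>)
      = 1 - (real p / (2 * \<xi> \<tau> ^ p)) / (\<xi>' \<tau>)\<^sup>2"
    using x by (simp add: power2_eq_square diff_divide_distrib)
  also have "(real p / (2 * \<xi> \<tau> ^ p)) / (\<xi>' \<tau>)\<^sup>2 = real p / (2 * (\<xi> \<tau> ^ p - 1))"
    using x energy[of \<tau>] \<tau> by (simp add: field_simps)
  finally show ?thesis by (simp add: algebra_simps)
qed

lemma crossing_cont: "0 < a \<Longrightarrow> continuous_on {a..b} (crossing h)"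
  by (rule DERIV_continuous_on[OF has_field_derivative_at_within[OF crossing_deriv]]) auto

lemma profile_at_right_0:
  shows "(\<xi> \<longlongrightarrow> 1) (at_right 0)" and inverse_\<xi>'_at_right_0: "filterlim (\<lambda>\<tau>. inverse (\<xi>' \<tau>)) at_top (at_right 0)"
proof -
  have "(\<xi> \<longlongrightarrow> \<xi> 0) (at_right 0)" "(\<xi>' \<longlongrightarrow> \<xi>' 0) (at_right 0)"
    using \<xi>_deriv[of 0] \<xi>'_deriv[of 0] DERIV_continuous[of \<xi> _ 0 "{0..}"] DERIV_continuous[of \<xi>' _ 0 "{0..}"]
    by (auto simp: continuous_within at_within_Ici_at_right)
  then have lim: "(\<xi> \<longlongrightarrow> 1) (at_right 0)" "(\<xi>' \<longlongrightarrow> 0) (at_right 0)"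
    by (auto simp: init)
  show "(\<xi> \<longlongrightarrow> 1) (at_right 0)" by (rule lim(1))
  have "filterlim \<xi>' (at_right 0) (at_right 0)"
    by (rule tendsto_imp_filterlim_at_right[OF lim(2) eventually_mono[OF eventually_at_right_less]])
      (rule \<xi>'_pos)
  then show "filterlim (\<lambda>\<tau>. inverse (\<xi>' \<tau>)) at_top (at_right 0)"
    by (rule filterlim_compose[OF filterlim_inverse_at_top_right])
qed

lemma crossing_at_right_0: "filterlim (crossing h) at_top (at_right 0)"
proof -
  have "filterlim (\<lambda>\<tau>. \<xi> \<tau> * inverse (\<xi>' \<tau>)) at_top (at_right 0)"
    by (rule filterlim_tendsto_pos_mult_at_top[OF profile_at_right_0(1) zero_less_one inverse_\<xi>'_at_right_0])
  moreover have "((\<lambda>\<tau>. - ((1 - h) * \<tau>)) \<longlongrightarrow> - ((1 - h) * 0)) (at_right 0)"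
    by (intro tendsto_intros)
  ultimately have "filterlim (\<lambda>\<tau>. - ((1 - h) * \<tau>) + \<xi> \<tau> * inverse (\<xi>' \<tau>)) at_top (at_right 0)"
    by (intro filterlim_tendsto_add_at_top)
  then show ?thesis
    by (simp add: crossing_def[abs_def] field_simps)
qed

text \<open>Because \<open>crossing h\<close> blows up at 0+, the intermediate value theorem reduces
  solvability to finding one time at which the function is at most w.\<close>

lemma crossing_hits:
  assumes "0 < b" "crossing h b \<le> w"
  shows "\<exists>\<tau>>0. crossing h \<tau> = w"
proof -
  have "\<forall>\<^sub>F \<tau> in at_right 0. w \<le> crossing h \<tau>"
    using crossing_at_right_0 by (simp add: filterlim_at_top)
  moreover have "\<forall>\<^sub>F \<tau> in at_right 0. \<tau> \<in> {0<..<b}"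
    using assms by (intro eventually_at_right_real)
  ultimately have "\<forall>\<^sub>F \<tau> in at_right 0. w \<le> crossing h \<tau> \<and> \<tau> \<in> {0<..<b}"
    by (rule eventually_conj)
  then obtain a where a: "w \<le> crossing h a" "0 < a" "a < b"
    using eventually_happens'[of "at_right (0::real)"] by auto
  then obtain \<tau> where "a \<le> \<tau>" "crossing h \<tau> = w"
    using IVT2'[of "crossing h" b w a] assms crossing_cont[of a] by auto
  then show ?thesis using a by (intro exI[of _ \<tau>]) auto
qed

lemma crossing_strict_antimono:
  assumes "h \<le> 0" "0 < a" "a < b"
  shows "crossing h b < crossing h a"
proof (rule DERIV_neg_imp_decreasing_open[OF assms(3)])
  fix s assume s: "a < s" "s < b"
  then have "1 < \<xi> s ^ p" using \<xi>_gt_1[of s] p assms by (intro one_less_power) auto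
  then have "0 < real p / (2 * (\<xi> s ^ p - 1))" using p by simp
  then have "h - real p / (2 * (\<xi> s ^ p - 1)) < 0" using assms by linarith
  then show "\<exists>y. (crossing h has_real_derivative y) (at s) \<and> y < 0"
    using crossing_deriv[of s h] s assms by auto
qed (use crossing_cont assms in auto)

text \<open>\<open>crossing h\<close> differs from the decreasing function \<open>crossing 0\<close>
  by the linear term h * \<tau>, so after time 1 it lies below a line of slope h < 0. The witness
  \<open>b\<close> is the time at which this line reaches w, or 1 if it starts below w.\<close>

lemma crossing_neg_slope:
  assumes "h < 0"
  shows "\<exists>\<tau>>0. crossing h \<tau> = w"
proof -
  define b where "b = max 1 (1 + (w - crossing h 1) / h)"
  have "1 \<le> b" by (simp add: b_def)
  have "crossing h b - h * b \<le> crossing h 1 - h * 1"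
  proof -
    have "crossing h \<tau> - h * \<tau> = crossing 0 \<tau>" for \<tau>
      by (simp add: crossing_def algebra_simps)
    moreover have "crossing 0 b \<le> crossing 0 1"
      using crossing_strict_antimono[of 0 1 b] \<open>1 \<le> b\<close> by (cases "b = 1") auto
    ultimately show ?thesis by (simp only:)
  qed
  moreover have "h * (b - 1) \<le> w - crossing h 1"
    using assms by (simp add: b_def max_def field_simps)
  ultimately have "crossing h b \<le> w" by (simp add: algebra_simps)
  then show ?thesis by (intro crossing_hits[of b]) (auto simp: b_def)
qed

lemma crossing_pos_slope:
  assumes h: "0 < h" and \<tau>: "0 < \<tau>" and crit: "\<xi> \<tau> ^ p = 1 + real p / (2 * h)"
  shows "(\<exists>s>0. crossing h s = w) \<longleftrightarrow> crossing h \<tau> \<le> w"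
proof -
  have p0: "0 < real p" using p by simp
  have mono: "\<xi> a ^ p < \<xi> b ^ p" if "0 < a" "a < b" for a b
    using \<xi>_strict_mono[of a b] pos[of a] that p by (intro power_strict_mono) auto
  have gt1: "1 < \<xi> a ^ p" if "0 < a" for a
    using \<xi>_gt_1[of a] p that by (intro one_less_power) auto
  \<comment> \<open>With h written as the value of p / (2 * (\<xi>^p - 1)) at \<tau>, the sign of
    the derivative at u is read off from comparing \<xi> u with \<xi> \<tau>.\<close>
  have h_eq: "h = real p / (2 * (\<xi> \<tau> ^ p - 1))" using h p by (simp add: crit)
  have "crossing h \<tau> \<le> crossing h s" if s: "0 < s" for s
  proof (cases s \<tau> rule: linorder_cases)
    case less
    show ?thesis
    proof (rule less_imp_le, rule DERIV_neg_imp_decreasing_open[OF less])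
      fix u assume u: "s < u" "u < \<tau>"
      have "real p / (2 * (\<xi> \<tau> ^ p - 1)) < real p / (2 * (\<xi> u ^ p - 1))"
        using mono[of u \<tau>] gt1[of u] u s p0 by (intro divide_strict_left_mono) auto
      then show "\<exists>y. (crossing h has_real_derivative y) (at u) \<and> y < 0"
        using crossing_deriv[of u h] u s h_eq
        by (intro exI[of _ "h - real p / (2 * (\<xi> u ^ p - 1))"]) auto
    qed (use crossing_cont s in auto)
  next
    case greater
    show ?thesis
    proof (rule less_imp_le, rule DERIV_pos_imp_increasing_open[OF greater])
      fix u assume u: "\<tau> < u" "u < s"
      have "real p / (2 * (\<xi> u ^ p - 1)) < real p / (2 * (\<xi> \<tau> ^ p - 1))"
        using mono[of \<tau> u] gt1[of \<tau>] u \<tau> p0 by (intro divide_strict_left_mono) auto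
      then show "\<exists>y. (crossing h has_real_derivative y) (at u) \<and> 0 < y"
        using crossing_deriv[of u h] u \<tau> h_eq
        by (intro exI[of _ "h - real p / (2 * (\<xi> u ^ p - 1))"]) auto
    qed (use crossing_cont \<tau> in auto)
  qed simp
  then show ?thesis using crossing_hits[OF \<tau>, of h w] by auto
qed

lemma critical_time:
  assumes "1 < c"
  obtains \<tau> where "0 < \<tau>" "\<xi> \<tau> ^ p = c"
proof -
  have "\<forall>\<^sub>F \<tau> in at_top. c \<le> \<xi> \<tau> \<and> 0 < \<tau>"
    using \<xi>_at_top by (intro eventually_conj eventually_gt_at_top) (simp add: filterlim_at_top)
  then obtain b where b: "c \<le> \<xi> b" "0 < b"
    using eventually_happens'[of "at_top :: real filter"] by auto
  have "\<xi> b ^ 1 \<le> \<xi> b ^ p" using b p \<xi>_gt_1[of b] by (intro power_increasing) auto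
  then have "\<exists>\<tau>. 0 \<le> \<tau> \<and> \<tau> \<le> b \<and> \<xi> \<tau> ^ p = c"
    using b assms init p by (intro IVT' continuous_intros cont) auto
  then obtain \<tau> where "0 \<le> \<tau>" "\<xi> \<tau> ^ p = c" by blast
  then show ?thesis using that[of \<tau>] assms init by (cases "\<tau> = 0") auto
qed

section \<open>Arrival time and the minimum of the crossing function\<close>

lemma \<xi>_powr:
  assumes "0 \<le> \<tau>"
  shows "(1 - (\<xi>' \<tau>)\<^sup>2) powr (- (1 / real p)) = \<xi> \<tau>"
proof -
  have "1 - (\<xi>' \<tau>)\<^sup>2 = \<xi> \<tau> powr (- real p)"
    using energy[OF assms] pos[OF assms] by (simp add: powr_minus powr_realpow divide_inverse)
  then show ?thesis using p pos[OF assms] by (simp add: powr_powr)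
qed

text \<open>With \<open>y = 1 / \<xi>'\<close> as the independent variable, \<open>\<xi> = (1 - 1/y\<^sup>2) powr (-1/p)\<close>
  and \<open>d\<tau> = y d\<xi>\<close>, so an integration by parts gives \<open>\<xi> y - \<tau> = y - J y\<close>, where
  \<open>J\<close> is the integral of \<open>\<xi> - 1\<close> over \<open>[y, \<infinity>)\<close>.\<close>

lemma arrival_time:
  fixes J :: "real \<Rightarrow> real"
  assumes J: "\<And>y. 1 < y \<Longrightarrow>
      (J has_real_derivative - ((1 - 1 / y\<^sup>2) powr (- (1 / real p)) - 1)) (at y)"
    and J_lim: "(J \<longlongrightarrow> 0) at_top"
    and \<tau>: "0 < \<tau>"
  shows "\<xi> \<tau> / \<xi>' \<tau> - \<tau> = 1 / \<xi>' \<tau> - J (1 / \<xi>' \<tau>)"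
proof -
  \<comment> \<open>\<open>W\<close> is the difference of the two sides of the claim, with \<xi> /
    \<xi>' and 1 / \<xi>' merged into (\<xi> - 1) / \<xi>' because each of them alone is infinite at
    0. It is constant, and its limit at 0+ is 0.\<close>
  define W where "W s = (\<xi> s - 1) / \<xi>' s - s + J (1 / \<xi>' s)" for s
  have W_deriv: "(W has_real_derivative 0) (at s)" if s: "0 < s" for s
  proof -
    let ?a = "real p / (2 * \<xi> s ^ Suc p)"
    have x: "0 < \<xi>' s" "\<xi>' s < 1" using s \<xi>'_pos \<xi>'_less_1 by auto
    have y: "((\<lambda>s. 1 / \<xi>' s) has_real_derivative - ?a / (\<xi>' s * \<xi>' s)) (at s)"
      using DERIV_divide[OF DERIV_const[of 1] deriv_at(2)[OF s]] x by simp
    have "(J has_real_derivative - (\<xi> s - 1)) (at (1 / \<xi>' s))"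
      using J[of "1 / \<xi>' s"] x \<xi>_powr[of s] s by (simp add: power_divide)
    then have "((\<lambda>s. J (1 / \<xi>' s)) has_real_derivative - (\<xi> s - 1) * (- ?a / (\<xi>' s * \<xi>' s))) (at s)"
      using y by (rule DERIV_chain2)
    moreover have "((\<lambda>s. (\<xi> s - 1) / \<xi>' s) has_real_derivative
        ((\<xi>' s - 0) * \<xi>' s - (\<xi> s - 1) * ?a) / (\<xi>' s * \<xi>' s)) (at s)"
      using x by (intro DERIV_divide DERIV_diff deriv_at s DERIV_const) auto
    ultimately have W': "(W has_real_derivative
        ((\<xi>' s - 0) * \<xi>' s - (\<xi> s - 1) * ?a) / (\<xi>' s * \<xi>' s) - 1
        + - (\<xi> s - 1) * (- ?a / (\<xi>' s * \<xi>' s))) (at s)"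
      unfolding W_def by (intro DERIV_add DERIV_diff DERIV_ident)
    \<comment> \<open>The second derivative \<open>a\<close> cancels whatever its value is: the
      equation of motion enters only through \<xi> = (1 - \<xi>'^2) powr (-1/p).\<close>
    have zero: "((b - 0) * b - (u - 1) * a) / (b * b) - 1 + - (u - 1) * (- a / (b * b)) = 0"
      if "0 < b" for a b u :: real
      using that by (simp add: field_simps)
    show ?thesis using W' unfolding zero[OF x(1)] .
  qed
  have const: "W s = W \<tau>" if "0 < s" for s
    using \<tau> that by (intro DERIV_isconst3[of 0 "s + \<tau> + 1"] W_deriv) auto
  have "((\<lambda>s. (\<xi> s - 1) / \<xi>' s) \<longlongrightarrow> 0) (at_right 0)"
  proof (rule tendsto_sandwich[OF _ _ tendsto_const])
    have *: "0 \<le> (\<xi> s - 1) / \<xi>' s \<and> (\<xi> s - 1) / \<xi>' s \<le> s" if "0 < s" for s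
      using \<xi>_le[of s] \<xi>'_pos[OF that] \<xi>_gt_1[OF that] that by (simp add: field_simps)
    show "\<forall>\<^sub>F s in at_right 0. 0 \<le> (\<xi> s - 1) / \<xi>' s"
      "\<forall>\<^sub>F s in at_right 0. (\<xi> s - 1) / \<xi>' s \<le> s"
      using * by (auto intro: eventually_mono[OF eventually_at_right_less])
  qed (rule tendsto_ident_at)
  moreover have "((\<lambda>s. J (1 / \<xi>' s)) \<longlongrightarrow> 0) (at_right 0)"
    using filterlim_compose[OF J_lim, of "\<lambda>s. inverse (\<xi>' s)"] inverse_\<xi>'_at_right_0
    by (simp add: inverse_eq_divide)
  ultimately have "(W \<longlongrightarrow> 0 - 0 + 0) (at_right 0)"
    unfolding W_def by (intro tendsto_intros)
  moreover have "(W \<longlongrightarrow> W \<tau>) (at_right 0)"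
    by (rule tendsto_eventually) (auto intro: eventually_mono[OF eventually_at_right_less] const)
  ultimately have "W \<tau> = 0"
    using tendsto_unique[of "at_right (0::real)"] by fastforce
  then show ?thesis by (simp add: W_def diff_divide_distrib)
qed

text \<open>\<open>J\<close> is kept abstract so that one computation serves p = 1, where it is a
  logarithm infinite at 1, and p \<ge> 3, where it is \<open>tail_integral\<close>. Splitting the
  value at the critical time as h * \<xi> / \<xi>' + (1 - h) * (\<xi> / \<xi>' - \<tau>) isolates
  the arrival-time expression; the energy identity turns the critical value of \<xi>^p into 1 /
  \<xi>' = sqrt (1 + 2 * h / p).\<close>

lemma crossing_minimum:
  fixes J :: "real \<Rightarrow> real"
  assumes J: "\<And>y. 1 < y \<Longrightarrow>
      (J has_real_derivative - ((1 - 1 / y\<^sup>2) powr (- (1 / real p)) - 1)) (at y)"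
    and J_lim: "(J \<longlongrightarrow> 0) at_top"
    and h: "0 < h"
  shows "(\<exists>\<tau>>0. crossing h \<tau> = w) \<longleftrightarrow>
    h * (1 + real p / (2 * h)) powr (1 / real p) * sqrt (1 + 2 * h / real p)
      + (1 - h) * (sqrt (1 + 2 * h / real p) - J (sqrt (1 + 2 * h / real p))) \<le> w"
proof -
  have "1 < 1 + real p / (2 * h)" using p h by simp
  then obtain \<tau> where \<tau>: "0 < \<tau>" "\<xi> \<tau> ^ p = 1 + real p / (2 * h)"
    by (rule critical_time)
  have x: "0 < \<xi> \<tau>" "0 < \<xi>' \<tau>" using \<tau> pos \<xi>'_pos by auto
  have "\<xi> \<tau> = (\<xi> \<tau> powr real p) powr (1 / real p)"
    using x p by (simp add: powr_powr)
  also have "\<xi> \<tau> powr real p = 1 + real p / (2 * h)"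
    using x \<tau> by (simp add: powr_realpow)
  finally have \<xi>_eq: "\<xi> \<tau> = (1 + real p / (2 * h)) powr (1 / real p)" .
  have "(\<xi>' \<tau>)\<^sup>2 = real p / (real p + 2 * h)"
    using energy[of \<tau>] \<tau>(1) h p unfolding \<tau>(2) by (simp add: field_simps)
  then have "(1 / \<xi>' \<tau>)\<^sup>2 = 1 + 2 * h / real p"
    using p by (simp add: power_divide add_divide_distrib)
  then have y_eq: "1 / \<xi>' \<tau> = sqrt (1 + 2 * h / real p)"
    using x by (intro real_sqrt_unique[symmetric]) auto
  have "crossing h \<tau> = h * \<xi> \<tau> * (1 / \<xi>' \<tau>) + (1 - h) * (\<xi> \<tau> / \<xi>' \<tau> - \<tau>)"
    by (simp add: crossing_def algebra_simps add_divide_distrib diff_divide_distrib)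
  also have "\<dots> = h * \<xi> \<tau> * (1 / \<xi>' \<tau>) + (1 - h) * (1 / \<xi>' \<tau> - J (1 / \<xi>' \<tau>))"
    using arrival_time[OF J J_lim \<tau>(1)] by simp
  finally show ?thesis
    unfolding crossing_pos_slope[OF h \<tau>] y_eq \<xi>_eq by simp
qed

text \<open>For p = 1 the derivative is -1 / (2 * (\<xi> - 1)) and \<xi> - 1 \<le> \<tau>, so the
  function falls at least as fast as -ln \<tau> / 2 and has no lower bound. The witness
  \<open>b\<close> is chosen so that this logarithm brings it down to w.\<close>

lemma crossing_zero_slope_1:
  assumes "p = 1"
  shows "\<exists>\<tau>>0. crossing 0 \<tau> = w"
proof -
  define b where "b = max 1 (exp (2 * (crossing 0 1 - w)))"
  have b: "1 \<le> b" by (simp add: b_def)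
  have "crossing 0 b + ln b / 2 \<le> crossing 0 1 + ln 1 / 2"
  proof (rule DERIV_nonpos_imp_nonincreasing[OF b])
    fix s assume s: "1 \<le> s" "s \<le> b"
    have "\<xi> s - 1 \<le> s * \<xi>' s" using \<xi>_le[of s] s by simp
    also have "\<dots> \<le> s * 1" using \<xi>'_less_1[of s] s by (intro mult_left_mono) auto
    finally have "1 / (2 * s) \<le> 1 / (2 * (\<xi> s - 1))"
      using \<xi>_gt_1[of s] s by (intro divide_left_mono) auto
    moreover have "((\<lambda>s. crossing 0 s + ln s / 2) has_real_derivative
        (0 - real p / (2 * (\<xi> s ^ p - 1))) + 1 / s / 2) (at s)"
      using s by (intro DERIV_add crossing_deriv DERIV_cdivide DERIV_ln_divide) auto
    ultimately show "\<exists>y. ((\<lambda>s. crossing 0 s + ln s / 2) has_real_derivative y) (at s) \<and> y \<le> 0"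
      using assms by (intro exI[of _ "(0 - real p / (2 * (\<xi> s ^ p - 1))) + 1 / s / 2"]) auto
  qed
  moreover have "2 * (crossing 0 1 - w) \<le> ln b"
    using b by (subst ln_ge_iff) (auto simp: b_def)
  ultimately have "crossing 0 b \<le> w" by simp
  then show ?thesis using b by (intro crossing_hits[of b]) auto
qed

text \<open>In dimension four the trajectory is explicit, \<xi>^2 = 1 + \<tau>^2: the energy
  identity makes the derivative of \<xi> * \<xi>' equal to 1.\<close>

lemma crossing_2:
  assumes "p = 2" and \<tau>: "0 < \<tau>"
  shows "crossing h \<tau> = 1 / \<tau> + h * \<tau>"
proof -
  have "\<xi> \<tau> * \<xi>' \<tau> - \<tau> = \<xi> 0 * \<xi>' 0 - 0"
  proof (rule DERIV_isconst_end[OF \<tau>])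
    show "continuous_on {0..\<tau>} (\<lambda>s. \<xi> s * \<xi>' s - s)"
      by (intro continuous_intros cont) auto
    fix s assume s: "0 < s" "s < \<tau>"
    have "((\<lambda>s. \<xi> s * \<xi>' s - s) has_real_derivative
        \<xi>' s * \<xi>' s + real p / (2 * \<xi> s ^ Suc p) * \<xi> s - 1) (at s)"
      using s by (intro DERIV_diff DERIV_mult deriv_at DERIV_ident)
    moreover have "\<xi>' s * \<xi>' s + real p / (2 * \<xi> s ^ Suc p) * \<xi> s - 1 = 0"
      using energy[of s] pos[of s] s assms(1) by (simp add: power2_eq_square numeral_eq_Suc)
    ultimately show "((\<lambda>s. \<xi> s * \<xi>' s - s) has_real_derivative 0) (at s)" by simp
  qed
  then have prod: "\<xi> \<tau> * \<xi>' \<tau> = \<tau>" by (simp add: init)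
  have x: "0 < \<xi> \<tau>" "0 < \<xi>' \<tau>" using \<tau> pos \<xi>'_pos by auto
  have "\<tau>\<^sup>2 = (\<xi> \<tau>)\<^sup>2 * (1 - 1 / (\<xi> \<tau>)\<^sup>2)"
    using energy[of \<tau>] \<tau> assms(1) prod by (metis less_imp_le power_mult_distrib)
  also have "\<dots> = (\<xi> \<tau>)\<^sup>2 - 1" using x by (simp add: field_simps)
  finally have sq: "(\<xi> \<tau>)\<^sup>2 = 1 + \<tau>\<^sup>2" by simp
  have "\<xi> \<tau> / \<xi>' \<tau> = (\<xi> \<tau>)\<^sup>2 / (\<xi> \<tau> * \<xi>' \<tau>)"
    using x by (simp add: power2_eq_square)
  also have "\<dots> = 1 / \<tau> + \<tau>"
    unfolding prod sq using \<tau> by (simp add: add_divide_distrib power2_eq_square)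
  finally show ?thesis by (simp add: crossing_def algebra_simps)
qed

lemma crossing_zero_slope_2:
  assumes "p = 2"
  shows "(\<exists>\<tau>>0. crossing 0 \<tau> = w) \<longleftrightarrow> 0 < w"
proof
  assume "0 < w"
  then have "crossing 0 (1 / w) = w" using crossing_2[OF assms, of "1 / w"] by simp
  then show "\<exists>\<tau>>0. crossing 0 \<tau> = w" using \<open>0 < w\<close> by (intro exI[of _ "1 / w"]) simp
qed (auto simp: crossing_2[OF assms])

text \<open>The inequality between arithmetic and geometric mean for 1 / \<tau> and h * \<tau>, with
  equality at \<tau> = 1 / sqrt h.\<close>

lemma crossing_pos_slope_2:
  assumes "p = 2" and h: "0 < h"
  shows "(\<exists>\<tau>>0. crossing h \<tau> = w) \<longleftrightarrow> 2 * sqrt h \<le> w"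
proof
  assume "\<exists>\<tau>>0. crossing h \<tau> = w"
  then obtain \<tau> where \<tau>: "0 < \<tau>" "1 / \<tau> + h * \<tau> = w"
    using crossing_2[OF assms(1)] by auto
  have "0 \<le> (1 - sqrt h * \<tau>)\<^sup>2 / \<tau>" using \<tau> by simp
  also have "\<dots> = 1 / \<tau> + h * \<tau> - 2 * sqrt h"
    using \<tau>(1) h by (simp add: power2_diff power_mult_distrib field_simps power2_eq_square)
  finally show "2 * sqrt h \<le> w" using \<tau> by simp
next
  assume "2 * sqrt h \<le> w"
  moreover have "crossing h (1 / sqrt h) = 2 * sqrt h"
    using h crossing_2[OF assms(1), of "1 / sqrt h" h] by (simp add: real_div_sqrt)
  ultimately show "\<exists>\<tau>>0. crossing h \<tau> = w"
    using h by (intro crossing_hits[of "1 / sqrt h"]) auto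
qed

text \<open>In the variable y = 1 / \<xi>' the function is the strictly increasing \<open>D\<close>,
  and y runs through the open interval (1, \<infinity>). The infimum \<open>D 1\<close> is therefore
  approached but not attained, which makes the inequality strict.\<close>

lemma crossing_zero_slope_3:
  assumes "3 \<le> p"
  shows "(\<exists>\<tau>>0. crossing 0 \<tau> = w) \<longleftrightarrow> 1 - tail_integral (p + 2) 1 < w"
proof -
  define D where "D y = y - tail_integral (p + 2) y" for y
  have n: "5 \<le> p + 2" using assms by simp
  have D_cont: "continuous_on {1..b} D" for b
    unfolding D_def by (intro continuous_intros continuous_on_tail_integral n)
  have J: "(tail_integral (p + 2) has_real_derivative
      - ((1 - 1 / y\<^sup>2) powr (- (1 / real p)) - 1)) (at y)" if "1 < y" for y
    using tail_integral_deriv[OF n that] by simp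
  have eq: "crossing 0 \<tau> = D (1 / \<xi>' \<tau>)" if "0 < \<tau>" for \<tau>
    using arrival_time[OF J tail_integral_at_top[OF n] that] by (simp add: crossing_def D_def)
  show ?thesis
  proof
    assume "\<exists>\<tau>>0. crossing 0 \<tau> = w"
    then obtain \<tau> where \<tau>: "0 < \<tau>" "crossing 0 \<tau> = w" by blast
    have y: "1 < 1 / \<xi>' \<tau>" using \<xi>'_pos[OF \<tau>(1)] \<xi>'_less_1[of \<tau>] \<tau> by simp
    have "D 1 < D (1 / \<xi>' \<tau>)"
    proof (rule DERIV_pos_imp_increasing_open[OF y _ D_cont])
      fix y :: real assume y: "1 < y"
      have "(D has_real_derivative 1 - - ((1 - 1 / y\<^sup>2) powr (- (1 / real p)) - 1)) (at y)"
        unfolding D_def by (intro DERIV_diff DERIV_ident J y)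
      moreover have "0 < (1 - 1 / y\<^sup>2) powr (- (1 / real p))"
        using y by (simp add: power2_eq_1_iff)
      ultimately show "\<exists>D'. (D has_real_derivative D') (at y) \<and> 0 < D'"
        by auto
    qed
    then show "1 - tail_integral (p + 2) 1 < w"
      using eq[OF \<tau>(1)] \<tau>(2) by (simp add: D_def)
  next
    assume w: "1 - tail_integral (p + 2) 1 < w"
    have "(D \<longlongrightarrow> D 1) (at_right 1)"
      using bspec[OF D_cont[of 2, unfolded continuous_on_def], of 1]
      by (simp add: at_within_Icc_at_right)
    moreover have "D 1 < w" using w by (simp add: D_def)
    ultimately have "\<forall>\<^sub>F y in at_right 1. D y < w" by (rule order_tendstoD)
    then have "\<forall>\<^sub>F y in at_right 1. D y < w \<and> 1 < y"
      by (rule eventually_conj) (rule eventually_at_right_less)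
    then obtain y where y: "D y < w" "1 < y"
      using eventually_happens'[of "at_right (1::real)"] by auto
    have "1 < y\<^sup>2" using one_less_power[OF y(2), of 2] by simp
    then have "0 < 1 / y\<^sup>2" "1 / y\<^sup>2 < 1"
      using y(2) by (auto simp: divide_less_eq_1_pos)
    then have "1 < 1 / (1 - 1 / y\<^sup>2)" by (subst less_divide_eq_1_pos) auto
    \<comment> \<open>By the energy identity this is the time at which 1 / \<xi>' equals y.\<close>
    then obtain \<tau> where \<tau>: "0 < \<tau>" "\<xi> \<tau> ^ p = 1 / (1 - 1 / y\<^sup>2)"
      by (rule critical_time)
    have "(\<xi>' \<tau>)\<^sup>2 = (1 / y)\<^sup>2"
      using energy[of \<tau>] \<tau> by (simp add: power_divide)
    then have "\<xi>' \<tau> = 1 / y"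
      using \<xi>'_pos[OF \<tau>(1)] y(2) by (subst (asm) power2_eq_iff_nonneg) auto
    then have "crossing 0 \<tau> < w" using eq[OF \<tau>(1)] y(1) by simp
    then show "\<exists>\<tau>>0. crossing 0 \<tau> = w" using \<tau> by (intro crossing_hits[of \<tau>]) auto
  qed
qed

end

section \<open>Breakdown along a characteristic starting at rest\<close>

text \<open>The three terms come from the invariance of the equation under scaling and time translation;
  \<open>q\<close> is adjusted to the inhomogeneity \<open>k'\<close>.\<close>

lemma linearized_flow:
  fixes x x' :: "real \<Rightarrow> real"
  assumes x: "(x has_real_derivative x' t) (at t within S)"
    and x': "(x' has_real_derivative k / x t ^ N) (at t within S)"
    and pos: "0 < x t"
    and k': "k' = k * (real N + 1) / R + 2 * q * k"
  shows "((\<lambda>t. x t / R + q * t * x' t + s * x' t) has_real_derivative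
      x' t / R + q * (x' t + t * (k / x t ^ N)) + s * (k / x t ^ N)) (at t within S)" (is ?first)
    and "((\<lambda>t. x' t / R + q * (x' t + t * (k / x t ^ N)) + s * (k / x t ^ N)) has_real_derivative
      k' / x t ^ N - real N * k * (x t / R + q * t * x' t + s * x' t) / x t ^ Suc N) (at t within S)"
      (is ?second)
proof -
  have "((\<lambda>t. x t / R + q * (t * x' t) + s * x' t) has_real_derivative
      x' t / R + q * (1 * x' t + k / x t ^ N * t) + s * (k / x t ^ N)) (at t within S)"
    by (intro DERIV_add DERIV_cdivide DERIV_cmult DERIV_mult DERIV_ident x x')
  then show ?first by (simp add: algebra_simps)
  let ?j = "k * (- (real N / x t ^ Suc N) * x' t)"
  have "((\<lambda>t. k * (1 / x t ^ N)) has_real_derivative ?j) (at t within S)"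
    by (intro DERIV_cmult DERIV_chain2[OF inverse_power_deriv] x pos)
  then have x'': "((\<lambda>t. k / x t ^ N) has_real_derivative ?j) (at t within S)" by simp
  have "((\<lambda>t. x' t / R + q * (x' t + t * (k / x t ^ N)) + s * (k / x t ^ N)) has_real_derivative
      k / x t ^ N / R + q * (k / x t ^ N + (1 * (k / x t ^ N) + ?j * t)) + s * ?j) (at t within S)"
    by (intro DERIV_add DERIV_cdivide DERIV_cmult DERIV_mult DERIV_ident x' x'')
  moreover have "k / x t ^ N / R + q * (k / x t ^ N + (1 * (k / x t ^ N) + ?j * t)) + s * ?j
      = k' / x t ^ N - real N * k * (x t / R + q * t * x' t + s * x' t) / x t ^ Suc N"
  proof -
    have "k' / x t ^ N - real N * k * (x t / R + q * t * x' t + s * x' t) / x t ^ Suc N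
        = k' / x t ^ N - real N * (k / x t ^ N) / R - real N * k * (q * t * x' t + s * x' t) / x t ^ Suc N"
      using pos by (simp add: add_divide_distrib distrib_left algebra_simps)
    also have "\<dots> = (k / x t ^ N) / R + 2 * q * (k / x t ^ N)
        - real N * k * (q * t * x' t + s * x' t) / x t ^ Suc N"
      by (simp add: k' add_divide_distrib distrib_left algebra_simps)
    finally show ?thesis by (simp add: algebra_simps add_divide_distrib)
  qed
  ultimately show ?second by simp
qed

section \<open>The mass function and the algebra of the threshold formulas\<close>

lemma mass_deriv:
  assumes "continuous_on {0..} rho0" "0 < R"
  shows "(mass n rho0 has_real_derivative rho0 R * R ^ (n - 1)) (at R)"
proof -
  have "continuous_on {0..2 * R} (\<lambda>s. rho0 s * s ^ (n - 1))"
    using assms by (intro continuous_intros) (auto elim: continuous_on_subset)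
  then have "((\<lambda>r. integral {0..r} (\<lambda>s. rho0 s * s ^ (n - 1))) has_real_derivative
      rho0 R * R ^ (n - 1)) (at R within {0..2 * R})"
    using assms by (intro integral_has_real_derivative) auto
  then show ?thesis using assms by (simp add: at_within_Icc_at mass_def[abs_def])
qed

lemma mass_nonneg:
  assumes "\<And>r. 0 \<le> r \<Longrightarrow> 0 \<le> rho0 r"
  shows "0 \<le> mass n rho0 r"
\<comment> \<open>Without integrability \<open>integral\<close> takes its default value 0, which
  satisfies the bound as well.\<close>
proof (cases "(\<lambda>s. rho0 s * s ^ (n - 1)) integrable_on {0..r}")
  case True
  then show ?thesis unfolding mass_def using assms by (intro integral_nonneg) auto
qed (simp add: mass_def not_integrable_integral)

text \<open>Here \<open>u\<close> stands for \<open>R \<partial>\<^sub>rC\<close>.\<close>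

lemma threshold_dim_3:
  fixes C u :: real
  defines "h \<equiv> u / (2 * C)" and "y \<equiv> sqrt (1 + u / C)"
  assumes C: "0 < C" and u: "0 < u"
  shows "sqrt C / 2 * (h * (1 + 1 / (2 * h)) * y + (1 - h) * (y - ln ((y + 1) / (y - 1)) / 2))
    = 3 / 4 * sqrt (C + u) - sqrt C / 2 * (1 - h) * ln ((sqrt C + sqrt (C + u)) / sqrt u)"
proof -
  have h: "0 < h" using C u by (simp add: h_def)
  have y: "1 < y" and c: "sqrt C \<noteq> 0" using C u by (auto simp: y_def)
  have sum: "sqrt (C + u) = sqrt C * y"
    using C by (simp add: y_def field_simps flip: real_sqrt_mult)
  have "u = C * (y\<^sup>2 - 1)" using C u by (simp add: y_def add_nonneg_nonneg)
  then have sqrt_u: "sqrt u = sqrt C * sqrt (y\<^sup>2 - 1)" by (simp add: real_sqrt_mult)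
  have "y\<^sup>2 - 1 = (y - 1) * (y + 1)" by (simp add: power2_eq_square algebra_simps)
  moreover have "(y + 1) / sqrt ((y - 1) * (y + 1)) = sqrt ((y + 1) / (y - 1))"
  proof (rule real_sqrt_unique[symmetric])
    show "((y + 1) / sqrt ((y - 1) * (y + 1)))\<^sup>2 = (y + 1) / (y - 1)"
      using y by (simp add: power_divide power2_eq_square)
  qed (use y in auto)
  moreover have "(sqrt C + sqrt (C + u)) / sqrt u = (sqrt C * (y + 1)) / (sqrt C * sqrt (y\<^sup>2 - 1))"
    by (simp add: sum sqrt_u algebra_simps)
  ultimately have "(sqrt C + sqrt (C + u)) / sqrt u = sqrt ((y + 1) / (y - 1))"
    by (simp only: mult_divide_mult_cancel_left[OF c])
  then have "ln ((sqrt C + sqrt (C + u)) / sqrt u) = ln ((y + 1) / (y - 1)) / 2"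
    using y by (simp add: ln_sqrt)
  \<comment> \<open>Here h * (1 + 1 / (2 * h)) + (1 - h) = 3/2; times sqrt C / 2 this is the origin
    of the coefficient 3/4.\<close>
  then show ?thesis using h unfolding sum by (simp add: field_simps)
qed

text \<open>Since y is sqrt Z times sqrt (u / (p * C)), the two powers of \<open>Z\<close> combine
  to the exponent 1/p + 1/2 = (p + 2) / (2 * p), that is n / (2 * (n - 2)); the leftover square
  roots produce u powr (3/2) and sqrt p.\<close>

lemma threshold_dim_ge_5:
  fixes C u p J :: real
  defines "h \<equiv> u / (2 * C)" and "y \<equiv> sqrt (1 + u / (p * C))"
  assumes C: "0 < C" and u: "0 < u" and p: "0 < p"
  shows "p * sqrt C / 2 * (h * (1 + p / (2 * h)) powr (1 / p) * y + (1 - h) * (y - J))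
    = sqrt p * u powr (3 / 2) / (4 * C) * (1 + p * C / u) powr ((p + 2) / (2 * p))
      + p * sqrt C / 2 * (1 - h) * (y - J)"
proof -
  define Z where "Z = 1 + p * C / u"
  have Z: "0 < Z" using C u p by (simp add: Z_def add_pos_pos)
  have h_Z: "1 + p / (2 * h) = Z" using C u by (simp add: Z_def h_def)
  have "1 + u / (p * C) = Z * (u / (p * C))"
    using C u p by (simp add: Z_def field_simps)
  then have y: "y = Z powr (1 / 2) * (sqrt u / (sqrt p * sqrt C))"
    using Z by (simp add: y_def real_sqrt_mult real_sqrt_divide powr_half_sqrt)
  have "Z powr ((p + 2) / (2 * p)) = Z powr (1 / p) * Z powr (1 / 2)"
    using p by (simp add: field_simps flip: powr_add)
  moreover have "u powr (3 / 2) = u * sqrt u"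
    using u powr_add[of u 1 "1 / 2"] by (simp add: powr_half_sqrt)
  moreover have "p * sqrt C / 2 * (h * Z powr (1 / p) * y)
      = p * sqrt C / 2 * h * (sqrt u / (sqrt p * sqrt C)) * (Z powr (1 / p) * Z powr (1 / 2))"
    unfolding y by (simp only: ac_simps times_divide_eq_right times_divide_eq_left divide_divide_eq_left)
  moreover have "p * sqrt C / 2 * h * (sqrt u / (sqrt p * sqrt C)) = sqrt p * (u * sqrt u) / (4 * C)"
  proof -
    have "p * sqrt C / 2 * h * (sqrt u / (sqrt p * sqrt C)) = (p / sqrt p) * (u * sqrt u) / (4 * C)"
      using C by (simp add: h_def)
    then show ?thesis using p by (simp add: real_div_sqrt)
  qed
  ultimately have "p * sqrt C / 2 * (h * Z powr (1 / p) * y)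
      = sqrt p * u powr (3 / 2) / (4 * C) * Z powr ((p + 2) / (2 * p))"
    by (simp only:)
  then show ?thesis by (simp add: h_Z distrib_left mult.assoc flip: Z_def)
qed

text \<open>This is \<open>characteristic_curve\<close> unpacked for all starting points at once,
  with the existentially bound velocities collected into one function \<open>V\<close>. Writing n as
  p + 2 avoids truncated subtraction in the exponents.\<close>

locale characteristic_at_rest =
  fixes lam R :: real and p :: nat and rho0 v0 :: "real \<Rightarrow> real"
    and X V :: "real \<Rightarrow> real \<Rightarrow> real" and T :: "real \<Rightarrow> ereal"
  assumes data: "admissible_data rho0 v0"
    and lam: "lam < 0"
    and p: "1 \<le> p"
    and R: "0 < R"
    and v0_R: "v0 R = 0"
    and T_pos: "\<And>r. 0 < r \<Longrightarrow> 0 < T r"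
    and X_0: "\<And>r. 0 < r \<Longrightarrow> X 0 r = r"
    and V_0: "\<And>r. 0 < r \<Longrightarrow> V 0 r = v0 r"
    and X_pos: "\<And>r t. 0 < r \<Longrightarrow> 0 \<le> t \<Longrightarrow> ereal t < T r \<Longrightarrow> 0 < X t r"
    and X_deriv: "\<And>r t. 0 < r \<Longrightarrow> 0 \<le> t \<Longrightarrow> ereal t < T r \<Longrightarrow>
      ((\<lambda>t. X t r) has_real_derivative V t r) (at t within {0..})"
    and V_deriv: "\<And>r t. 0 < r \<Longrightarrow> 0 \<le> t \<Longrightarrow> ereal t < T r \<Longrightarrow>
      ((\<lambda>t. V t r) has_real_derivative - lam * mass (p + 2) rho0 r / X t r ^ Suc p)
        (at t within {0..})"
    and exit: "\<And>r \<tau>. 0 < r \<Longrightarrow> T r = ereal \<tau> \<Longrightarrow> ((\<lambda>t. X t r) \<longlongrightarrow> 0) (at_left \<tau>)"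
begin

definition k :: "real \<Rightarrow> real" where "k r = - lam * mass (p + 2) rho0 r"
definition C :: real where "C = C_fun lam (p + 2) rho0 v0 R"
definition dC :: real where "dC = deriv (C_fun lam (p + 2) rho0 v0) R"
definition k' :: real where "k' = - lam * (rho0 R * R ^ Suc p)"
definition dv :: real where "dv = deriv v0 R"

definition breakdown :: bool where
  "breakdown \<longleftrightarrow> (\<exists>tc. 0 < tc \<and> ereal tc \<le> T R \<and>
     (X tc R = 0 \<or> ((\<lambda>r. X tc r) has_real_derivative 0) (at R)))"

lemma k_deriv: "(k has_real_derivative k') (at R)"
  using DERIV_cmult[OF mass_deriv[of rho0 R "p + 2"], of "- lam"] data R
  by (simp add: admissible_data_def k_def[abs_def] k'_def)

lemma k_nonneg: "0 \<le> k r"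
  using mass_nonneg[of rho0 "p + 2" r] data lam
  by (simp add: admissible_data_def k_def mult_nonpos_nonneg)

lemma v0_deriv: "(v0 has_real_derivative dv) (at R)"
proof -
  obtain D where "\<And>x. x \<in> {0<..} \<Longrightarrow> (v0 has_vector_derivative D x) (at x)"
    using data by (auto simp: admissible_data_def C1_differentiable_on_def)
  then have "(v0 has_real_derivative D R) (at R)"
    using R by (simp add: has_real_derivative_iff_has_vector_derivative)
  then show ?thesis by (simp add: dv_def DERIV_imp_deriv)
qed

lemma C_fun_eq: "C_fun lam (p + 2) rho0 v0 r = (v0 r)\<^sup>2 + 2 / real p * (k r * (1 / r ^ p))"
  using lam by (simp add: C_fun_def A_fun_def k_def)

lemma C_eq: "C = 2 * k R / (real p * R ^ p)"
  unfolding C_def C_fun_eq v0_R by simp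

lemma dC_eq: "dC = 2 * k' / (real p * R ^ p) - 2 * k R / R ^ Suc p"
proof -
  have "((\<lambda>r. (v0 r)\<^sup>2 + 2 / real p * (k r * (1 / r ^ p))) has_real_derivative
      2 * v0 R * dv + 2 / real p * (k' * (1 / R ^ p) + - (real p / R ^ Suc p) * k R)) (at R)"
    by (intro DERIV_add DERIV_cmult DERIV_mult k_deriv inverse_power_deriv R)
      (auto intro!: derivative_eq_intros v0_deriv)
  then have "dC = 2 * v0 R * dv + 2 / real p * (k' * (1 / R ^ p) + - (real p / R ^ Suc p) * k R)"
    unfolding dC_def C_fun_eq by (rule DERIV_imp_deriv)
  also have "\<dots> = 2 * k' / (real p * R ^ p) - 2 * k R / R ^ Suc p"
    using p R by (simp add: v0_R field_simps)
  finally show ?thesis .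
qed

lemma V_deriv_k:
  assumes "0 < r" "0 \<le> t" "ereal t < T r"
  shows "((\<lambda>t. V t r) has_real_derivative k r / X t r ^ Suc p) (at t within {0..})"
  using V_deriv[OF assms] by (simp add: k_def)

lemma V_R_nonneg:
  assumes "0 \<le> t" "ereal t < T R"
  shows "0 \<le> V t R"
proof -
  have less: "ereal s < T R" if "s \<le> t" for s
    using that assms by (auto intro: le_less_trans[of _ "ereal t"])
  have "V 0 R \<le> V t R"
  proof (rule DERIV_nonneg_imp_increasing_open[OF assms(1)])
    fix s assume s: "0 < s" "s < t"
    then have "((\<lambda>t. V t R) has_real_derivative k R / X s R ^ Suc p) (at s)"
      using V_deriv_k[OF R, of s] less[of s] at_within_interior[of s "{0..}"] by simp
    then show "\<exists>y. ((\<lambda>t. V t R) has_real_derivative y) (at s) \<and> 0 \<le> y"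
      using X_pos[OF R, of s] less[of s] s k_nonneg
      by (intro exI[of _ "k R / X s R ^ Suc p"]) auto
  next
    show "continuous_on {0..t} (\<lambda>t. V t R)"
      using less by (intro DERIV_continuous_on[OF has_field_derivative_subset[OF V_deriv_k]] R) auto
  qed
  then show ?thesis using V_0[OF R] v0_R by simp
qed

lemma X_R_ge:
  assumes "0 \<le> t" "ereal t < T R"
  shows "R \<le> X t R"
proof -
  have less: "ereal s < T R" if "s \<le> t" for s
    using that assms by (auto intro: le_less_trans[of _ "ereal t"])
  have "X 0 R \<le> X t R"
  proof (rule DERIV_nonneg_imp_increasing_open[OF assms(1)])
    fix s assume s: "0 < s" "s < t"
    then have "((\<lambda>t. X t R) has_real_derivative V s R) (at s)"
      using X_deriv[OF R, of s] less[of s] at_within_interior[of s "{0..}"] by simp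
    then show "\<exists>y. ((\<lambda>t. X t R) has_real_derivative y) (at s) \<and> 0 \<le> y"
      using V_R_nonneg[of s] less[of s] s by auto
  next
    show "continuous_on {0..t} (\<lambda>t. X t R)"
      using less by (intro DERIV_continuous_on[OF has_field_derivative_subset[OF X_deriv]] R) auto
  qed
  then show ?thesis using X_0[OF R] by simp
qed

lemma T_R: "T R = \<infinity>"
proof (rule ccontr)
  assume "T R \<noteq> \<infinity>"
  then obtain \<tau> where \<tau>: "T R = ereal \<tau>" "0 < \<tau>"
    using T_pos[OF R] by (cases "T R") auto
  have "\<forall>\<^sub>F s in at_left \<tau>. s \<in> {0<..<\<tau>}"
    using \<tau> by (intro eventually_at_left_real)
  then have "\<forall>\<^sub>F s in at_left \<tau>. R \<le> X s R"
    by eventually_elim (use \<tau> in \<open>auto intro: X_R_ge\<close>)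
  then have "R \<le> 0" using exit[OF R \<tau>(1)] by (intro tendsto_lowerbound) auto
  with R show False by simp
qed

text \<open>The derivative at R is unique, so any pair solving the linearized initial value problem
  decides breakdown; the point 0 itself is never reached.\<close>

lemma breakdown_iff_root:
  assumes \<Gamma>_0: "\<Gamma> 0 = 1" "\<Gamma>' 0 = dv"
    and \<Gamma>: "\<And>t. 0 \<le> t \<Longrightarrow> (\<Gamma> has_real_derivative \<Gamma>' t) (at t within {0..})"
    and \<Gamma>': "\<And>t. 0 \<le> t \<Longrightarrow>
      (\<Gamma>' has_real_derivative k' / X t R ^ Suc p - real (Suc p) * k R * \<Gamma> t / X t R ^ Suc (Suc p))
        (at t within {0..})"
  shows "breakdown \<longleftrightarrow> (\<exists>t>0. \<Gamma> t = 0)"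
proof -
  have deriv: "((\<lambda>r. X t r) has_real_derivative \<Gamma> t) (at R)" if "0 \<le> t" for t
  proof (rule has_real_derivative_initial_value[where X = X and t = t and \<Gamma> = \<Gamma> and R = R and X' = V and T = T and \<Gamma>' = \<Gamma>' and N = "Suc p"
        and \<kappa> = k and \<kappa>' = k' and v = v0 and v' = dv])
    show "R \<le> X s R" if "0 \<le> s" for s using X_R_ge[of s] that T_R by simp
  qed (rule R k_deriv k_nonneg v0_deriv T_pos X_0 V_0 X_deriv V_deriv_k exit T_R \<Gamma>_0 \<Gamma> \<Gamma>' that;
      assumption)+
  have "X t R \<noteq> 0" if "0 < t" for t
    using X_pos[OF R, of t] that T_R by simp
  moreover have "((\<lambda>r. X t r) has_real_derivative 0) (at R) \<longleftrightarrow> \<Gamma> t = 0" if "0 < t" for t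
    using deriv[of t] that DERIV_unique[of "\<lambda>r. X t r" "\<Gamma> t" R 0] by auto
  ultimately show ?thesis by (auto simp: breakdown_def T_R)
qed

text \<open>The nonnegative function \<open>k\<close> has a minimum at R, so \<open>k'\<close>
  vanishes as well. The linearized equation becomes \<Gamma>'' = 0, with solution 1 + dv *
  t.\<close>

lemma massless:
  assumes "k R = 0"
  shows "C = 0" "dC = 0" "breakdown \<longleftrightarrow> dv < 0"
proof -
  have "k' = 0"
    by (rule DERIV_local_min[OF k_deriv zero_less_one]) (use k_nonneg assms in auto)
  then show "C = 0" "dC = 0" by (simp_all add: C_eq dC_eq assms)
  have "breakdown \<longleftrightarrow> (\<exists>t>0. 1 + dv * t = 0)"
    by (rule breakdown_iff_root[where \<Gamma>' = "\<lambda>t. dv"])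
      (use \<open>k' = 0\<close> assms in \<open>auto intro!: derivative_eq_intros\<close>)
  also have "\<dots> \<longleftrightarrow> dv < 0"
  proof
    assume "\<exists>t>0. 1 + dv * t = 0"
    then obtain t where "0 < t" "dv * t = - 1" by (auto simp: add_eq_0_iff)
    then show "dv < 0" by (metis mult_nonneg_nonneg less_imp_le linorder_not_le neg_0_le_iff_le not_one_le_zero)
  next
    assume "dv < 0"
    then show "\<exists>t>0. 1 + dv * t = 0" by (intro exI[of _ "- 1 / dv"]) (auto simp: divide_neg_neg)
  qed
  finally show "breakdown \<longleftrightarrow> dv < 0" .
qed

end

section \<open>Positive mass: normalization and the breakdown thresholds\<close>

locale massive_characteristic_at_rest = characteristic_at_rest +
  assumes k_pos: "0 < k R"
begin

definition \<xi> :: "real \<Rightarrow> real" where "\<xi> \<tau> = X (R * \<tau> / sqrt C) R / R"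
definition \<xi>' :: "real \<Rightarrow> real" where "\<xi>' \<tau> = V (R * \<tau> / sqrt C) R / sqrt C"

lemma C_pos: "0 < C"
  using k_pos p R by (simp add: C_eq)

lemma profile: "radial_profile p \<xi> \<xi>'"
proof
  let ?c = "sqrt C"
  have c: "0 < ?c" using C_pos by simp
  show "\<xi> 0 = 1" "\<xi>' 0 = 0" using X_0[OF R] V_0[OF R] R v0_R by (auto simp: \<xi>_def \<xi>'_def)
  fix \<tau> :: real assume \<tau>: "0 \<le> \<tau>"
  define t where "t = R * \<tau> / ?c"
  have t: "0 \<le> t" using \<tau> R c by (simp add: t_def)
  have time: "((\<lambda>\<tau>. R * \<tau> / ?c) has_real_derivative R / ?c) (at \<tau> within {0..})"
    using DERIV_cdivide[OF DERIV_cmult_Id[of R], of "?c"] by simp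
  have im: "(\<lambda>\<tau>. R * \<tau> / ?c) ` {0..} \<subseteq> {0..}" using R c by auto
  have tT: "ereal t < T R" using T_R by simp
  show "0 < \<xi> \<tau>" using X_pos[OF R t tT] R by (simp add: \<xi>_def t_def)
  have "((\<lambda>\<tau>. X (R * \<tau> / ?c) R) has_real_derivative V t R * (R / ?c)) (at \<tau> within {0..})"
    using DERIV_image_chain[OF has_field_derivative_subset[OF X_deriv[OF R t tT, unfolded t_def] im] time]
      by (simp add: t_def comp_def)
  then show "(\<xi> has_real_derivative \<xi>' \<tau>) (at \<tau> within {0..})"
    using DERIV_cdivide[where c = R] R by (fastforce simp: \<xi>_def[abs_def] \<xi>'_def t_def)
  have "((\<lambda>\<tau>. V (R * \<tau> / ?c) R) has_real_derivative k R / X t R ^ Suc p * (R / ?c))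
      (at \<tau> within {0..})"
    using DERIV_image_chain[OF has_field_derivative_subset[OF V_deriv_k[OF R t tT, unfolded t_def] im] time]
      by (simp add: t_def comp_def)
  then have "(\<xi>' has_real_derivative k R / X t R ^ Suc p * (R / ?c) / ?c) (at \<tau> within {0..})"
    unfolding \<xi>'_def[abs_def] by (rule DERIV_cdivide)
  moreover have "k R / X t R ^ Suc p * (R / ?c) / ?c = real p / (2 * \<xi> \<tau> ^ Suc p)"
  proof -
    have "k R / X t R ^ Suc p * (R / ?c) / ?c = k R / X t R ^ Suc p * R / C"
      using real_sqrt_mult_self[of C] C_pos
      by (simp only: times_divide_eq_right divide_divide_eq_left abs_of_pos mult.assoc)
    also have "\<dots> = real p * (R * R ^ p) / (2 * X t R ^ Suc p)"
      using k_pos p R by (simp add: C_eq ac_simps)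
    also have "\<dots> = real p / (2 * \<xi> \<tau> ^ Suc p)"
      using R by (simp add: \<xi>_def t_def power_divide)
    finally show ?thesis .
  qed
  ultimately show "(\<xi>' has_real_derivative real p / (2 * \<xi> \<tau> ^ Suc p)) (at \<tau> within {0..})" by simp
qed (rule p)

end

sublocale massive_characteristic_at_rest \<subseteq> radial_profile p \<xi> \<xi>'
  by (rule profile)

context massive_characteristic_at_rest
begin

definition h :: real where "h = R * dC / (2 * C)"

lemma breakdown_iff_crossing:
  "breakdown \<longleftrightarrow> (\<exists>\<tau>>0. crossing h \<tau> = - (2 * (dv * R) / (real p * sqrt C)))"
proof -
  \<comment> \<open>\<open>q\<close> is forced by k' / k = dC / C + p / R, which must equal (p + 2)
    / R + 2 * q. \<open>s\<close> is forced by \<Gamma>'(0) = dv: the velocity vanishes at time 0,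
    so \<Gamma>'(0) is s times the initial acceleration p * C / (2 * R). Rescaling the velocity by
    sqrt C turns \<open>s\<close> into \<open>w\<close>.\<close>
  define q where "q = dC / (2 * C) - 1 / R"
  define s where "s = 2 * dv * R / (real p * C)"
  define w where "w = 2 * (dv * R) / (real p * sqrt C)"
  have c: "0 < sqrt C" "C \<noteq> 0" using C_pos by auto
  have p0: "0 < real p" using p by simp
  have k'_eq: "k' = k R * (real (Suc p) + 1) / R + 2 * q * k R"
  proof -
    have "k' = k R * (dC / C + real p / R)"
      using k_pos p0 R by (simp add: dC_eq C_eq field_simps)
    then show ?thesis by (simp add: q_def algebra_simps add_divide_distrib)
  qed
  have pos_t: "0 < X t R" if "0 \<le> t" for t using X_pos[OF R that] T_R by simp
  note flow = linearized_flow[OF X_deriv[OF R] V_deriv_k[OF R] pos_t k'_eq]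
  have "breakdown \<longleftrightarrow> (\<exists>t>0. X t R / R + q * t * V t R + s * V t R = 0)"
  proof (rule breakdown_iff_root[where
        \<Gamma>' = "\<lambda>t. V t R / R + q * (V t R + t * (k R / X t R ^ Suc p)) + s * (k R / X t R ^ Suc p)"])
    show "V 0 R / R + q * (V 0 R + 0 * (k R / X 0 R ^ Suc p)) + s * (k R / X 0 R ^ Suc p) = dv"
      using R k_pos p0 by (simp add: X_0 V_0 v0_R s_def C_eq)
  qed (use flow T_R R in \<open>auto simp: X_0 V_0 v0_R simp del: power_Suc of_nat_Suc\<close>)
  also have "\<dots> \<longleftrightarrow> (\<exists>\<tau>>0. \<xi> \<tau> - (1 - h) * \<tau> * \<xi>' \<tau> + w * \<xi>' \<tau> = 0)"
  proof -
    have eq: "X t R / R + q * t * V t R + s * V t R = \<xi> \<tau> - (1 - h) * \<tau> * \<xi>' \<tau> + w * \<xi>' \<tau>"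
      if "t = R * \<tau> / sqrt C" for t \<tau>
    proof -
      have "V t R = sqrt C * \<xi>' \<tau>" "X t R / R = \<xi> \<tau>"
        using c that by (auto simp: \<xi>_def \<xi>'_def)
      moreover have "q * t * sqrt C = - (1 - h) * \<tau>"
        using c R by (simp add: that q_def h_def field_simps)
      moreover have "s * sqrt C = w"
        using c C_pos p0 by (simp add: s_def w_def field_simps)
      ultimately show ?thesis
        by (metis (no_types, lifting) diff_conv_add_uminus minus_mult_left mult.assoc)
    qed
    show ?thesis
    proof
      assume "\<exists>t>0. X t R / R + q * t * V t R + s * V t R = 0"
      then obtain t where "0 < t" "X t R / R + q * t * V t R + s * V t R = 0" by blast
      then show "\<exists>\<tau>>0. \<xi> \<tau> - (1 - h) * \<tau> * \<xi>' \<tau> + w * \<xi>' \<tau> = 0"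
        using eq[of t "sqrt C * t / R"] c R by (intro exI[of _ "sqrt C * t / R"]) auto
    next
      assume "\<exists>\<tau>>0. \<xi> \<tau> - (1 - h) * \<tau> * \<xi>' \<tau> + w * \<xi>' \<tau> = 0"
      then obtain \<tau> where "0 < \<tau>" "\<xi> \<tau> - (1 - h) * \<tau> * \<xi>' \<tau> + w * \<xi>' \<tau> = 0" by blast
      then show "\<exists>t>0. X t R / R + q * t * V t R + s * V t R = 0"
        using eq[OF refl, of \<tau>] c R by (intro exI[of _ "R * \<tau> / sqrt C"]) auto
    qed
  qed
  also have "\<dots> \<longleftrightarrow> (\<exists>\<tau>>0. crossing h \<tau> = - w)"
  proof -
    have "\<xi> \<tau> - (1 - h) * \<tau> * \<xi>' \<tau> + w * \<xi>' \<tau> = 0 \<longleftrightarrow> crossing h \<tau> = - w" if "0 < \<tau>" for \<tau>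
    proof -
      have "\<xi> \<tau> - (1 - h) * \<tau> * \<xi>' \<tau> + w * \<xi>' \<tau> = (crossing h \<tau> + w) * \<xi>' \<tau>"
        using \<xi>'_pos[OF that] by (simp add: crossing_def algebra_simps)
      then show ?thesis using \<xi>'_pos[OF that] by auto
    qed
    then show ?thesis by blast
  qed
  finally show ?thesis by (simp add: w_def)
qed

lemma threshold_le: "m \<le> - (2 * a / (real p * sqrt C)) \<longleftrightarrow> a \<le> - (real p * sqrt C / 2 * m)"
  and threshold_less: "m < - (2 * a / (real p * sqrt C)) \<longleftrightarrow> a < - (real p * sqrt C / 2 * m)"
proof -
  have "0 < real p * sqrt C" using p C_pos by simp
  then show "m \<le> - (2 * a / (real p * sqrt C)) \<longleftrightarrow> a \<le> - (real p * sqrt C / 2 * m)"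
    "m < - (2 * a / (real p * sqrt C)) \<longleftrightarrow> a < - (real p * sqrt C / 2 * m)"
    by (auto simp: field_simps simp flip: minus_divide_left)
qed

lemma breakdown_neg: "dC < 0 \<Longrightarrow> breakdown"
  unfolding breakdown_iff_crossing using C_pos R
  by (intro crossing_neg_slope) (simp add: h_def divide_neg_pos mult_pos_neg)

lemma breakdown_zero:
  assumes "dC = 0"
  shows "p = 1 \<Longrightarrow> breakdown"
    and "p = 2 \<Longrightarrow> breakdown \<longleftrightarrow> dv * R < 0"
    and "3 \<le> p \<Longrightarrow> breakdown \<longleftrightarrow> dv * R < - (real p * sqrt C / 2) * (1 - tail_integral (p + 2) 1)"
proof -
  have h: "h = 0" using assms by (simp add: h_def)
  show "p = 1 \<Longrightarrow> breakdown"
    unfolding breakdown_iff_crossing h by (rule crossing_zero_slope_1)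
  show "p = 2 \<Longrightarrow> breakdown \<longleftrightarrow> dv * R < 0"
    unfolding breakdown_iff_crossing h crossing_zero_slope_2 threshold_less by simp
  show "3 \<le> p \<Longrightarrow> breakdown \<longleftrightarrow> dv * R < - (real p * sqrt C / 2) * (1 - tail_integral (p + 2) 1)"
    unfolding breakdown_iff_crossing h crossing_zero_slope_3 threshold_less by simp
qed

lemma breakdown_pos:
  assumes dC: "0 < dC"
  shows "p = 1 \<Longrightarrow> breakdown \<longleftrightarrow> dv * R \<le> - (3 / 4) * sqrt (C + R * dC)
      + sqrt C / 2 * (1 - R * dC / (2 * C)) * ln ((sqrt C + sqrt (C + R * dC)) / sqrt (R * dC))"
    and "p = 2 \<Longrightarrow> breakdown \<longleftrightarrow> dv * R \<le> - sqrt (2 * R * dC)"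
    and "3 \<le> p \<Longrightarrow> q = 1 + R * dC / (real p * C) \<Longrightarrow> breakdown \<longleftrightarrow> dv * R \<le>
      - (sqrt (real p) * (R * dC) powr (3 / 2) / (4 * C))
          * (1 + real p * C / (R * dC)) powr ((real p + 2) / (2 * real p))
      - real p * sqrt C / 2 * (1 - R * dC / (2 * C)) * (sqrt q - tail_integral (p + 2) (sqrt q))"
proof -
  have u: "0 < R * dC" using R dC by simp
  have h: "0 < h" using u C_pos by (simp add: h_def)
  have h2: "2 * h / real p = R * dC / (real p * C)" by (simp add: h_def)
  {
    assume p1: "p = 1"
    \<comment> \<open>For p = 1 the integrand is 1 / (y^2 - 1), and this is minus its antiderivative
      vanishing at infinity, the inverse hyperbolic cotangent. It diverges at 1, but only arguments
      y > 1 occur since h > 0.\<close>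
    define J where "J y = ln ((y + 1) / (y - 1)) / 2" for y :: real
    have J: "(J has_real_derivative - ((1 - 1 / y\<^sup>2) powr (- (1 / real p)) - 1)) (at y)" if y: "1 < y" for y
    proof -
      have y2: "1 < y\<^sup>2" using one_less_power[OF y, of 2] by simp
      have "((\<lambda>y. (ln (y + 1) - ln (y - 1)) / 2) has_real_derivative (1 / (y + 1) - 1 / (y - 1)) / 2) (at y)"
        using y by (auto intro!: derivative_eq_intros)
      moreover have "\<forall>\<^sub>F y in nhds y. (ln (y + 1) - ln (y - 1)) / 2 = J y"
        by (rule eventually_mono[OF eventually_nhds_in_open[of "{1<..}"]])
          (use y in \<open>auto simp: J_def ln_div\<close>)
      ultimately have "(J has_real_derivative (1 / (y + 1) - 1 / (y - 1)) / 2) (at y)"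
        by (subst DERIV_cong_ev[OF refl _ refl, symmetric])
      moreover have "(1 - 1 / y\<^sup>2) powr (- (1 / real p)) = y\<^sup>2 / (y\<^sup>2 - 1)"
      proof -
        have "1 - 1 / y\<^sup>2 = (y\<^sup>2 - 1) / y\<^sup>2" "0 < (y\<^sup>2 - 1) / y\<^sup>2"
          using y y2 by (auto simp: field_simps)
        then show ?thesis
          by (simp only: p1 of_nat_1 div_by_1 powr_minus powr_one[OF less_imp_le] inverse_divide)
      qed
      moreover have "(1 / (y + 1) - 1 / (y - 1)) / 2 = - (y\<^sup>2 / (y\<^sup>2 - 1) - 1)"
        using y y2 by (simp add: field_simps power2_eq_square)
      ultimately show ?thesis by simp
    qed
    have J_lim: "(J \<longlongrightarrow> 0) at_top" unfolding J_def by real_asymp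
    have "(\<exists>\<tau>>0. crossing h \<tau> = m) \<longleftrightarrow>
        h * (1 + real p / (2 * h)) powr (1 / real p) * sqrt (1 + 2 * h / real p)
        + (1 - h) * (sqrt (1 + 2 * h / real p) - J (sqrt (1 + 2 * h / real p))) \<le> m" for m
      by (rule crossing_minimum[OF _ J_lim h]) (rule J)
    note minimum = this
    have "breakdown \<longleftrightarrow> dv * R \<le> - (sqrt C / 2 * (h * (1 + 1 / (2 * h)) * sqrt (1 + R * dC / C)
        + (1 - h) * (sqrt (1 + R * dC / C) - J (sqrt (1 + R * dC / C)))))"
      unfolding breakdown_iff_crossing minimum threshold_le h2
      using h by (simp add: p1)
    then show "breakdown \<longleftrightarrow> dv * R \<le> - (3 / 4) * sqrt (C + R * dC)
      + sqrt C / 2 * (1 - R * dC / (2 * C)) * ln ((sqrt C + sqrt (C + R * dC)) / sqrt (R * dC))"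
      unfolding J_def h_def threshold_dim_3[OF C_pos u] by simp
  }
  {
    assume p2: "p = 2"
    have "sqrt C * (2 * sqrt h) = sqrt (2 * R * dC)"
    proof -
      have "sqrt C * (2 * sqrt h) = sqrt (C * (4 * h))" by (simp add: real_sqrt_mult)
      also have "C * (4 * h) = 2 * R * dC" using C_pos by (simp add: h_def)
      finally show ?thesis .
    qed
    then show "breakdown \<longleftrightarrow> dv * R \<le> - sqrt (2 * R * dC)"
      unfolding breakdown_iff_crossing crossing_pos_slope_2[OF p2 h] threshold_le
      by (simp add: p2)
  }
  {
    assume p3: "3 \<le> p" and q: "q = 1 + R * dC / (real p * C)"
    have n: "5 \<le> p + 2" using p3 by simp
    have J: "(tail_integral (p + 2) has_real_derivative
        - ((1 - 1 / y\<^sup>2) powr (- (1 / real p)) - 1)) (at y)" if "1 < y" for y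
      using tail_integral_deriv[OF n that] by simp
    have p0: "0 < real p" using p by simp
    have "(\<exists>\<tau>>0. crossing h \<tau> = m) \<longleftrightarrow>
        h * (1 + real p / (2 * h)) powr (1 / real p) * sqrt (1 + 2 * h / real p)
        + (1 - h) * (sqrt (1 + 2 * h / real p)
          - tail_integral (p + 2) (sqrt (1 + 2 * h / real p))) \<le> m" for m
      by (rule crossing_minimum[OF _ tail_integral_at_top[OF n] h]) (rule J)
    note minimum = this
    show "breakdown \<longleftrightarrow> dv * R \<le>
      - (sqrt (real p) * (R * dC) powr (3 / 2) / (4 * C))
          * (1 + real p * C / (R * dC)) powr ((real p + 2) / (2 * real p))
      - real p * sqrt C / 2 * (1 - R * dC / (2 * C)) * (sqrt q - tail_integral (p + 2) (sqrt q))"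
      unfolding breakdown_iff_crossing minimum
        threshold_le h2 q
      unfolding h_def threshold_dim_ge_5[OF C_pos u p0] by simp
  }
qed

end

theorem proposition1p9:
  fixes lam R :: real and n :: nat
    and rho0 v0 :: "real \<Rightarrow> real"
    and X :: "real \<Rightarrow> real \<Rightarrow> real" and T :: "real \<Rightarrow> ereal"
  assumes data: "admissible_data rho0 v0"
    and lam: "lam < 0"
    and n: "3 \<le> n"
    and X: "\<And>r. 0 < r \<Longrightarrow> characteristic_curve lam n rho0 v0 r (T r) (\<lambda>t. X t r)"
    and R: "0 < R"
    and v0_R: "v0 R = 0"
    and nondegenerate: "n = 3 \<Longrightarrow> 0 < mass n rho0 R"
  shows "(5 \<le> n \<longrightarrow> tail_integral n 1 < 1) \<and>
    (let C = C_fun lam n rho0 v0 R;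
         dC = deriv (C_fun lam n rho0 v0) R;
         dv = deriv v0 R;
         q = 1 + R * dC / ((real n - 2) * C)
     in
       (\<exists>tc. 0 < tc \<and> ereal tc \<le> T R \<and>
             (X tc R = 0 \<or> ((\<lambda>r. X tc r) has_real_derivative 0) (at R)))
       \<longleftrightarrow>
       (dC < 0 \<or>
        (dC = 0 \<and>
          (n = 3 \<or>
           (n = 4 \<and> dv * R < 0) \<or>
           (5 \<le> n \<and> dv * R < - ((real n - 2) * sqrt C / 2) * (1 - tail_integral n 1)))) \<or>
        (0 < dC \<and>
          ((n = 3 \<and>
             dv * R \<le> - (3 / 4) * sqrt (C + R * dC)
               + sqrt C / 2 * (1 - R * dC / (2 * C))
                 * ln ((sqrt C + sqrt (C + R * dC)) / sqrt (R * dC))) \<or>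
           (n = 4 \<and> dv * R \<le> - sqrt (2 * R * dC)) \<or>
           (5 \<le> n \<and>
             dv * R \<le>
               - (sqrt (real n - 2) * (R * dC) powr (3 / 2) / (4 * C))
                   * (1 + (real n - 2) * C / (R * dC)) powr (real n / (2 * (real n - 2)))
               - (real n - 2) * sqrt C / 2 * (1 - R * dC / (2 * C))
                   * (sqrt q - tail_integral n (sqrt q)))))))"
proof -
  obtain p where p: "n = p + 2" "1 \<le> p"
    using n by (intro that[of "n - 2"]) auto
  have np: "real n = real p + 2" by (simp add: p)
  have "\<exists>x'. x' 0 = v0 r \<and> (\<forall>t. 0 \<le> t \<and> ereal t < T r \<longrightarrow>
      ((\<lambda>t. X t r) has_real_derivative x' t) (at t within {0..}) \<and>
      (x' has_real_derivative - lam * mass n rho0 r / X t r ^ (n - 1)) (at t within {0..}))"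
    if "0 < r" for r
    using X[OF that] by (auto simp: characteristic_curve_def)
  then obtain V where V: "\<And>r. 0 < r \<Longrightarrow> V r 0 = v0 r"
    "\<And>r t. 0 < r \<Longrightarrow> 0 \<le> t \<Longrightarrow> ereal t < T r \<Longrightarrow>
      ((\<lambda>t. X t r) has_real_derivative V r t) (at t within {0..})"
    "\<And>r t. 0 < r \<Longrightarrow> 0 \<le> t \<Longrightarrow> ereal t < T r \<Longrightarrow>
      (V r has_real_derivative - lam * mass n rho0 r / X t r ^ (n - 1)) (at t within {0..})"
    by metis
  interpret ch: characteristic_at_rest lam R p rho0 v0 X "\<lambda>t r. V r t" T
    using data lam p R v0_R X V
    by unfold_locales (auto simp: characteristic_curve_def)
  have main: "ch.breakdown \<longleftrightarrow>
       (ch.dC < 0 \<or>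
        (ch.dC = 0 \<and>
          (n = 3 \<or>
           (n = 4 \<and> ch.dv * R < 0) \<or>
           (5 \<le> n \<and> ch.dv * R < - (real p * sqrt ch.C / 2) * (1 - tail_integral n 1)))) \<or>
        (0 < ch.dC \<and>
          ((n = 3 \<and>
             ch.dv * R \<le> - (3 / 4) * sqrt (ch.C + R * ch.dC)
               + sqrt ch.C / 2 * (1 - R * ch.dC / (2 * ch.C))
                 * ln ((sqrt ch.C + sqrt (ch.C + R * ch.dC)) / sqrt (R * ch.dC))) \<or>
           (n = 4 \<and> ch.dv * R \<le> - sqrt (2 * R * ch.dC)) \<or>
           (5 \<le> n \<and>
             ch.dv * R \<le>
               - (sqrt (real p) * (R * ch.dC) powr (3 / 2) / (4 * ch.C))
                   * (1 + real p * ch.C / (R * ch.dC)) powr ((real p + 2) / (2 * real p))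
               - real p * sqrt ch.C / 2 * (1 - R * ch.dC / (2 * ch.C))
                   * (sqrt (1 + R * ch.dC / (real p * ch.C))
                     - tail_integral n (sqrt (1 + R * ch.dC / (real p * ch.C))))))))"
  proof (cases "ch.k R = 0")
    case True
    \<comment> \<open>Without mass C = dC = 0, and breakdown means dv < 0. For n \<ge> 4 the clauses
      for dC = 0 reduce to just that, but the clause n = 3 would assert breakdown for every dv;
      \<open>nondegenerate\<close> rules this out.\<close>
    have "p \<noteq> 1" using nondegenerate True lam p by (auto simp: ch.k_def)
    then have "n = 4 \<or> 5 \<le> n" "n \<noteq> 3" using p by auto
    then show ?thesis using ch.massless[OF True] R by (auto simp: mult_less_0_iff)
  next
    case False
    then interpret massive: massive_characteristic_at_rest lam R p rho0 v0 X "\<lambda>t r. V r t" T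
      using ch.k_nonneg[of R] by unfold_locales simp
    consider "p = 1" | "p = 2" | "3 \<le> p" using p by linarith
    then show ?thesis
      using massive.breakdown_neg massive.breakdown_zero massive.breakdown_pos
      by cases (cases "ch.dC" "0 :: real" rule: linorder_cases; simp add: p)+
  qed
  show ?thesis
    unfolding Let_def np add_diff_cancel_right'
    using main[unfolded ch.breakdown_def ch.C_def ch.dC_def ch.dv_def, folded p(1)]
      tail_integral_1_less[of n]
    by (intro conjI impI)
qed

end
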